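(* Let $\overrightarrow{\mathcal G}$ be a directed graph with $k$ vertices that is a stable root extension of an admissible directed graph $\overrightarrow{\mathcal H}$ with $\ell$ vertices. Then $\overrightarrow{\mathcal G}$ is admissible. If moreover, for some generic target $p^*$ (a configuration of the vertices of $\overrightarrow{\mathcal G}$), the non-zero eigenvalues of $Z_{\overrightarrow{\mathcal H}}$ have positive real parts, where $Z_{\overrightarrow{\mathcal H}}$ is the edge operator of $\overrightarrow{\mathcal H}$ at the restriction of $p^*$ to the vertices of $\overrightarrow{\mathcal H}$, then $\overrightarrow{\mathcal G}$ is strongly admissible.
   Context: Fix $d\ge1$. Directed graphs are orientations of finite simple graphs. For a graph with vertex set $\{1,\dots,n\}$ and edge set $\mathcal E$, a configuration is $p=(p_1,\dots,p_n)\in\mathbb R^{dn}$; the distance map is $F(p)=(\|p_j-p_i\|^2)_{ij\in\mathcal E}$; the rigidity matrix $R(p)\in\mathbb R^{|\mathcal E|\times dn}$ has, in the row of edge $ij$, the block $(p_i-p_j)^\top$ at vertex $i$, $(p_j-p_i)^\top$ at vertex $j$, and zeros elsewhere. The graph is generically $d$-rigid if for generic $p$ every $q$ sufficiently close to $p$ with $F(q)=F(p)$ is congruent to $p$. Given an orientation, $\overrightarrow R(p)$ is obtained from $R(p)$ by keeping, in the row of $\overrightarrow{ij}$ (tail $i$, head $j$), only the block at the tail $i$. The edge operator is $Z(p)=2R(p)\overrightarrow R(p)^\top$; its image lies in $\operatorname{im}R(p)$. A directed graph is admissible if its underlying graph is generically $d$-rigid and, for every generic $p$, $Z(p)|_{\operatorname{im}R(p)}$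 is invertible; it is strongly admissible if its underlying graph is generically $d$-rigid and, for every generic $p$, all eigenvalues of $Z(p)|_{\operatorname{im}R(p)}$ have non-zero real part. Genericity: "for every generic $p$" means for all $p$ outside some proper algebraic subset $X$ of configuration space defined over $\mathbb Q$. A result with a hypothesis "for some generic target $p^*$" asserts that there is such an $X$, depending only on $d$ and the directed graphs, for which the result holds whenever the hypothesis is satisfied at some $p^*\notin X$. Let $\overrightarrow{\mathcal H}\subseteq\overrightarrow{\mathcal G}$ be a vertex-induced subgraph, and let $\overrightarrow{\mathcal G}\setminus\overrightarrow{\mathcal H}$ be the subgraph induced by the remaining vertices. $\overrightarrow{\mathcal G}$ is a root extension of $\overrightarrow{\mathcal H}$ if $\overrightarrow{\mathcal G}\setminus\overrightarrow{\mathcal H}$ is acyclic and there are no directed edges from a vertex of $\overrightarrow{\mathcal H}$ to a vertex of $\overrightarrow{\mathcal G}\setminus\overrightarrow{\mathcal H}$. It is a stable root extension if, in addition, $\overrightarrow{\mathcal H}$ is admissible and every vertex of $\overrightarrow{\mathcal G}\setminus\overrightarrow{\mathcal H}$ has out-degree (in $\overrightarrow{\mathcal G}$) at least $d$. *)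

theory Defs
  imports "Graph_Theory.Digraph_Component" "HOL-Analysis.Analysis"
begin

text \<open>
  A vector indexed by a finite set \<open>I\<close> is a function that vanishes outside \<open>I\<close>. With real-vector
  entries and \<open>I\<close> a vertex set this is the configuration space; with real entries and \<open>I\<close> a set of
  arcs it is the space on which the edge operator acts.
\<close>

definition vectors_on :: "'i set \<Rightarrow> ('i \<Rightarrow> 'b::zero) set" where
  "vectors_on I = {x. \<forall>i. i \<notin> I \<longrightarrow> x i = 0}"

definition restrict_config :: "'v set \<Rightarrow> ('v \<Rightarrow> real^'d) \<Rightarrow> 'v \<Rightarrow> real^'d" where
  "restrict_config W p = (\<lambda>v. if v \<in> W then p v else 0)"


section \<open>Genericity\<close>

text \<open>Polynomial functions with rational coefficients in the coordinates of the points \<open>p v\<close>, \<open>v \<in> V\<close>.\<close>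

inductive rat_poly_fun :: "'v set \<Rightarrow> (('v \<Rightarrow> real^'d) \<Rightarrow> real) \<Rightarrow> bool" for V where
  const: "c \<in> \<rat> \<Longrightarrow> rat_poly_fun V (\<lambda>p. c)"
| coord: "v \<in> V \<Longrightarrow> rat_poly_fun V (\<lambda>p. p v $ i)"
| add: "rat_poly_fun V f \<Longrightarrow> rat_poly_fun V g \<Longrightarrow> rat_poly_fun V (\<lambda>p. f p + g p)"
| mult: "rat_poly_fun V f \<Longrightarrow> rat_poly_fun V g \<Longrightarrow> rat_poly_fun V (\<lambda>p. f p * g p)"

definition rat_algebraic_set :: "'v set \<Rightarrow> ('v \<Rightarrow> real^'d) set \<Rightarrow> bool" where
  "rat_algebraic_set V X \<longleftrightarrow>
     (\<exists>P. finite P \<and> (\<forall>f\<in>P. rat_poly_fun V f) \<and> X = {p \<in> vectors_on V. \<forall>f\<in>P. f p = 0})"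

definition for_generic :: "'v set \<Rightarrow> (('v \<Rightarrow> real^'d) \<Rightarrow> bool) \<Rightarrow> bool" where
  "for_generic V Q \<longleftrightarrow>
     (\<exists>X. rat_algebraic_set V X \<and> X \<subset> vectors_on V \<and> (\<forall>p \<in> vectors_on V - X. Q p))"


section \<open>Directed graphs and rigidity\<close>

text \<open>Asymmetry of the arc relation excludes loops and pairs of opposite arcs.\<close>

definition oriented_graph :: "'v pair_pre_digraph \<Rightarrow> bool" where
  "oriented_graph G \<longleftrightarrow> pair_digraph G \<and> asym (parcs G)"

text \<open>
  In an oriented graph the edges of the underlying graph correspond bijectively to the arcs, so
  edge-indexed objects are indexed by arcs. The distance map and the rigidity matrix are symmetric
  in the two ends of an edge and hence depend on the underlying graph only.
\<close>

definition distance_map :: "'v pair_pre_digraph \<Rightarrow> ('v \<Rightarrow> real^'d) \<Rightarrow> 'v \<times> 'v \<Rightarrow> real" where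
  "distance_map G p = (\<lambda>(i, j). if (i, j) \<in> parcs G then (norm (p j - p i))\<^sup>2 else 0)"

definition congruent_on :: "'v set \<Rightarrow> ('v \<Rightarrow> real^'d) \<Rightarrow> ('v \<Rightarrow> real^'d) \<Rightarrow> bool" where
  "congruent_on V p q \<longleftrightarrow>
     (\<exists>f :: real^'d \<Rightarrow> real^'d. (\<forall>x y. dist (f x) (f y) = dist x y) \<and> (\<forall>v\<in>V. q v = f (p v)))"

definition locally_rigid :: "'v pair_pre_digraph \<Rightarrow> ('v \<Rightarrow> real^'d) \<Rightarrow> bool" where
  "locally_rigid G p \<longleftrightarrow>
     (\<exists>\<epsilon>>0. \<forall>q \<in> vectors_on (pverts G).
        (\<forall>v \<in> pverts G. dist (q v) (p v) < \<epsilon>) \<longrightarrow> distance_map G q = distance_map G p \<longrightarrow>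
        congruent_on (pverts G) p q)"

definition generically_rigid :: "'d::finite itself \<Rightarrow> 'v pair_pre_digraph \<Rightarrow> bool" where
  "generically_rigid d G \<longleftrightarrow> for_generic (pverts G) (\<lambda>p :: 'v \<Rightarrow> real^'d. locally_rigid G p)"


section \<open>Rigidity matrices and the edge operator\<close>

text \<open>
  The matrices with rows indexed by arcs and \<open>d\<close> columns per vertex are given by their blocks: the
  entry at arc \<open>e\<close> and vertex \<open>v\<close> is a vector in \<open>\<real>\<^sup>d\<close>.
\<close>

definition rigidity_matrix :: "('v \<Rightarrow> real^'d) \<Rightarrow> 'v \<times> 'v \<Rightarrow> 'v \<Rightarrow> real^'d" where
  "rigidity_matrix p = (\<lambda>(i, j) v. if v = i then p i - p j else if v = j then p j - p i else 0)"

definition directed_rigidity_matrix :: "('v \<Rightarrow> real^'d) \<Rightarrow> 'v \<times> 'v \<Rightarrow> 'v \<Rightarrow> real^'d" where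
  "directed_rigidity_matrix p = (\<lambda>(i, j) v. if v = i then rigidity_matrix p (i, j) v else 0)"

definition rigidity_image :: "'v pair_pre_digraph \<Rightarrow> ('v \<Rightarrow> real^'d) \<Rightarrow> ('v \<times> 'v \<Rightarrow> real) set" where
  "rigidity_image G p =
     (\<lambda>x e. if e \<in> parcs G then \<Sum>v\<in>pverts G. rigidity_matrix p e v \<bullet> x v else 0) `
       vectors_on (pverts G)"

definition edge_matrix ::
    "'v pair_pre_digraph \<Rightarrow> ('v \<Rightarrow> real^'d) \<Rightarrow> 'v \<times> 'v \<Rightarrow> 'v \<times> 'v \<Rightarrow> real" where
  "edge_matrix G p e f =
     2 * (\<Sum>v\<in>pverts G. rigidity_matrix p e v \<bullet> directed_rigidity_matrix p f v)"

text \<open>Multiplication by the real edge matrix, used on real and on complex vectors.\<close>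

definition edge_operator ::
    "'v pair_pre_digraph \<Rightarrow> ('v \<Rightarrow> real^'d) \<Rightarrow> ('v \<times> 'v \<Rightarrow> 'k::real_vector) \<Rightarrow> 'v \<times> 'v \<Rightarrow> 'k" where
  "edge_operator G p w =
     (\<lambda>e. if e \<in> parcs G then \<Sum>f\<in>parcs G. edge_matrix G p e f *\<^sub>R w f else 0)"

lemma edge_operator_in_rigidity_image:
  fixes p :: "'v \<Rightarrow> real^'d" and w :: "'v \<times> 'v \<Rightarrow> real"
  shows "edge_operator G p w \<in> rigidity_image G p"
proof -
  define x where "x = (\<lambda>v. if v \<in> pverts G
    then \<Sum>f\<in>parcs G. (2 * w f) *\<^sub>R directed_rigidity_matrix p f v else 0)"
  have "(\<Sum>f\<in>parcs G. edge_matrix G p e f *\<^sub>R w f) =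
      (\<Sum>v\<in>pverts G. rigidity_matrix p e v \<bullet> x v)" for e
    unfolding edge_matrix_def x_def
    by (simp add: inner_sum_right sum_distrib_left sum_distrib_right ac_simps)
       (rule sum.swap)
  then have "edge_operator G p w =
      (\<lambda>e. if e \<in> parcs G then \<Sum>v\<in>pverts G. rigidity_matrix p e v \<bullet> x v else 0)"
    by (auto simp: edge_operator_def)
  moreover have "x \<in> vectors_on (pverts G)"
    by (simp add: vectors_on_def x_def)
  ultimately show ?thesis
    unfolding rigidity_image_def by blast
qed

text \<open>
  Complex eigenvalues of a real operator on a real subspace \<open>S\<close>: eigenvectors are sought in the
  complexification of \<open>S\<close>, and \<open>T\<close> is the complex-linear extension of the operator.
\<close>

definition complexification :: "('e \<Rightarrow> real) set \<Rightarrow> ('e \<Rightarrow> complex) set" where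
  "complexification S = {\<lambda>e. Complex (a e) (b e) |a b. a \<in> S \<and> b \<in> S}"

definition eigenvalues_on ::
    "('e \<Rightarrow> real) set \<Rightarrow> (('e \<Rightarrow> complex) \<Rightarrow> 'e \<Rightarrow> complex) \<Rightarrow> complex set" where
  "eigenvalues_on S T =
     {\<mu>. \<exists>w \<in> complexification S. w \<noteq> (\<lambda>_. 0) \<and> T w = (\<lambda>e. \<mu> * w e)}"


section \<open>Admissibility and root extensions\<close>

definition admissible :: "'d::finite itself \<Rightarrow> 'v pair_pre_digraph \<Rightarrow> bool" where
  "admissible d G \<longleftrightarrow>
     generically_rigid d G \<and>
     for_generic (pverts G) (\<lambda>p :: 'v \<Rightarrow> real^'d.
       bij_betw (edge_operator G p) (rigidity_image G p) (rigidity_image G p))"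

definition strongly_admissible :: "'d::finite itself \<Rightarrow> 'v pair_pre_digraph \<Rightarrow> bool" where
  "strongly_admissible d G \<longleftrightarrow>
     generically_rigid d G \<and>
     for_generic (pverts G) (\<lambda>p :: 'v \<Rightarrow> real^'d.
       \<forall>\<mu> \<in> eigenvalues_on (rigidity_image G p) (edge_operator G p). Re \<mu> \<noteq> 0)"

definition root_extension :: "'v pair_pre_digraph \<Rightarrow> 'v pair_pre_digraph \<Rightarrow> bool" where
  "root_extension G H \<longleftrightarrow>
     induced_subgraph (with_proj H) (with_proj G) \<and>
     acyclic (arcs_ends (with_proj G \<restriction> (pverts G - pverts H))) \<and>
     (\<forall>(u, v) \<in> parcs G. \<not> (u \<in> pverts H \<and> v \<in> pverts G - pverts H))"

definition stable_root_extension ::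
    "'d::finite itself \<Rightarrow> 'v pair_pre_digraph \<Rightarrow> 'v pair_pre_digraph \<Rightarrow> bool" where
  "stable_root_extension d G H \<longleftrightarrow>
     root_extension G H \<and> admissible d H \<and>
     (\<forall>v \<in> pverts G - pverts H. CARD('d) \<le> out_degree (with_proj G) v)"

end

theory Submission
  imports Defs "HOL-Computational_Algebra.Fundamental_Theorem_Algebra"
begin

text \<open>
  The vertices outside \<open>H\<close> can be added to \<open>H\<close> one at a time so that each new vertex \<open>v\<close> is a source
  with at least \<open>d\<close> out-neighbours (\<open>root_extension_induct\<close>); so let \<open>G\<close> be \<open>G'\<close> with one such source
  added. An arc into \<open>v\<close> does not exist, hence \<open>Z\<close> is block triangular with blocks \<open>Z\<close> of \<open>G'\<close> and
  \<open>2 A A\<^sup>T\<close>, where the rows of \<open>A\<close> are the vectors \<open>p v - p h\<close> for the out-neighbours \<open>h\<close>. The point is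
  what the image of \<open>R\<close> looks like over zero in the first block: it consists of the \<open>A z\<close>
  (\<open>image_fibre\<close>), and there \<open>2 A A\<^sup>T\<close> is positive definite. So invertibility passes from \<open>G'\<close> to \<open>G\<close>
  (\<open>bij_extend\<close>), and so does positivity of the real parts of all eigenvalues
  (\<open>positive_spectrum_extend\<close>). Local rigidity passes to \<open>G\<close> by elementary geometry
  (\<open>locally_rigid_extend\<close>).

  The description of the image uses that every infinitesimal flex of \<open>G'\<close> is trivial on pairs of
  vertices, for generic \<open>p\<close>. This is a generic version of the Asimow--Roth theorem
  (\<open>generically_rigid_imp_infinitesimally_rigid\<close>): a non-trivial flex at a generic configuration
  belongs to a polynomial field of flexes, and Euler polygons along this field lead to a nearby
  configuration with the same edge lengths that is not congruent (\<open>lengthening_flow\<close>).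

  It remains to pass from one generic \<open>p\<close> where all eigenvalues of \<open>Z\<close> on the image have positive real
  part to generic configurations without imaginary eigenvalues
  (\<open>generic_positive_spectrum_imp_strongly_admissible\<close>). An imaginary eigenvalue produces a non-zero
  solution of the Sylvester equation \<open>Z W + W Z\<^sup>T = 0\<close> in the tensor square of the image, whereas a
  spectrum in the right half-plane excludes such solutions (\<open>positive_spectrum_sylvester\<close>). The existence
  of a solution is a linear condition whose coefficients are polynomials in \<open>p\<close>.

  Both generic arguments rest on one elimination lemma, \<open>generic_span_or_kernel\<close>: for polynomial
  vectors \<open>w e\<close> and \<open>g\<close>, either \<open>g\<close> lies in the span of the \<open>w e\<close> at generic configurations, or a
  polynomial vector is orthogonal to all \<open>w e\<close> and not to \<open>g\<close> at generic configurations.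
\<close>

section \<open>Rational polynomial functions and genericity\<close>

lemma rat_poly_fun_neg: "rat_poly_fun V f \<Longrightarrow> rat_poly_fun V (\<lambda>p. - f p)"
  using rat_poly_fun.mult[OF rat_poly_fun.const[of "-1" V], of f] by simp

lemma rat_poly_fun_diff:
  "rat_poly_fun V f \<Longrightarrow> rat_poly_fun V g \<Longrightarrow> rat_poly_fun V (\<lambda>p. f p - g p)"
  using rat_poly_fun.add[of V f "\<lambda>p. - g p"] rat_poly_fun_neg[of V g] by simp

lemma rat_poly_fun_sum:
  "(\<And>s. s \<in> S \<Longrightarrow> rat_poly_fun V (f s)) \<Longrightarrow> rat_poly_fun V (\<lambda>p. \<Sum>s\<in>S. f s p)"
  by (induction S rule: infinite_finite_induct)
    (auto intro: rat_poly_fun.const rat_poly_fun.add)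

lemma rat_poly_fun_prod:
  "(\<And>s. s \<in> S \<Longrightarrow> rat_poly_fun V (f s)) \<Longrightarrow> rat_poly_fun V (\<lambda>p. \<Prod>s\<in>S. f s p)"
  by (induction S rule: infinite_finite_induct)
    (auto intro: rat_poly_fun.const rat_poly_fun.mult)

lemmas rat_poly_fun_intros =
  rat_poly_fun.const rat_poly_fun.coord rat_poly_fun.add rat_poly_fun.mult
  rat_poly_fun_neg rat_poly_fun_diff rat_poly_fun_sum rat_poly_fun_prod

lemma rat_poly_fun_mono:
  assumes "rat_poly_fun V f" "V \<subseteq> W" shows "rat_poly_fun W f"
  using assms by induction (auto intro: rat_poly_fun.intros)

lemma rat_poly_fun_cong_on:
  assumes "rat_poly_fun V f" "\<And>v. v \<in> V \<Longrightarrow> p v = q v" shows "f p = f q"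
  using assms by induction auto

lemma rat_poly_fun_continuous: "rat_poly_fun V f \<Longrightarrow> continuous_on UNIV f"
  by (induction rule: rat_poly_fun.induct)
    (auto intro!: continuous_intros continuous_on_product_coordinates)

lemma rat_poly_fun_on_line:
  assumes "rat_poly_fun V f"
  shows "\<exists>P. \<forall>t. f (\<lambda>v. p v + t *\<^sub>R (q v - p v)) = poly P t"
  using assms
proof induction
  case (const c)
  show ?case by (intro exI[of _ "[:c:]"]) simp
next
  case (coord v i)
  show ?case by (intro exI[of _ "[:p v $ i, (q v - p v) $ i:]"]) simp
next
  case (add f g)
  then obtain P Q where "\<forall>t. f (\<lambda>v. p v + t *\<^sub>R (q v - p v)) = poly P t"
    "\<forall>t. g (\<lambda>v. p v + t *\<^sub>R (q v - p v)) = poly Q t" by blast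
  then show ?case by (intro exI[of _ "P + Q"]) simp
next
  case (mult f g)
  then obtain P Q where "\<forall>t. f (\<lambda>v. p v + t *\<^sub>R (q v - p v)) = poly P t"
    "\<forall>t. g (\<lambda>v. p v + t *\<^sub>R (q v - p v)) = poly Q t" by blast
  then show ?case by (intro exI[of _ "P * Q"]) simp
qed

definition nonzero_on :: "'v set \<Rightarrow> (('v \<Rightarrow> real^'d) \<Rightarrow> real) \<Rightarrow> bool" where
  "nonzero_on V f \<longleftrightarrow> (\<exists>p \<in> vectors_on V. f p \<noteq> 0)"

text \<open>
  Two polynomial functions that are not identically zero restrict to non-zero univariate polynomials
  on the line through their non-zeros, so their product is not identically zero either. This makes
  genericity stable under finite conjunctions.
\<close>

lemma nonzero_on_mult:
  assumes f: "rat_poly_fun V f" "nonzero_on V f" and g: "rat_poly_fun V g" "nonzero_on V g"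
  shows "nonzero_on V (\<lambda>p. f p * g p)"
proof -
  obtain p q where pq: "p \<in> vectors_on V" "f p \<noteq> 0" "q \<in> vectors_on V" "g q \<noteq> 0"
    using f g by (auto simp: nonzero_on_def)
  obtain P where P: "\<And>t. f (\<lambda>v. p v + t *\<^sub>R (q v - p v)) = poly P t"
    using rat_poly_fun_on_line[OF f(1)] by blast
  obtain Q where Q: "\<And>t. g (\<lambda>v. p v + t *\<^sub>R (q v - p v)) = poly Q t"
    using rat_poly_fun_on_line[OF g(1)] by blast
  have "P \<noteq> 0" using P[of 0] pq by auto
  moreover have "Q \<noteq> 0" using Q[of 1] pq by auto
  ultimately have "finite {t. poly (P * Q) t = 0}" by (intro poly_roots_finite) simp
  then obtain t where "poly (P * Q) t \<noteq> 0"
    using ex_new_if_finite[OF infinite_UNIV_char_0] by blast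
  moreover have "(\<lambda>v. p v + t *\<^sub>R (q v - p v)) \<in> vectors_on V"
    using pq by (auto simp: vectors_on_def)
  ultimately show ?thesis
    unfolding nonzero_on_def by (intro bexI[of _ "\<lambda>v. p v + t *\<^sub>R (q v - p v)"]) (auto simp: P Q)
qed

lemma for_generic_iff:
  "for_generic V Q \<longleftrightarrow>
     (\<exists>f. rat_poly_fun V f \<and> nonzero_on V f \<and> (\<forall>p \<in> vectors_on V. f p \<noteq> 0 \<longrightarrow> Q p))"
proof
  assume "for_generic V Q"
  then obtain P where P: "\<forall>f\<in>P. rat_poly_fun V f" "{p \<in> vectors_on V. \<forall>f\<in>P. f p = 0} \<subset> vectors_on V"
    "\<forall>p \<in> vectors_on V - {p \<in> vectors_on V. \<forall>f\<in>P. f p = 0}. Q p"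
    by (auto simp: for_generic_def rat_algebraic_set_def)
  then obtain f where "f \<in> P" "nonzero_on V f"
    by (auto simp: nonzero_on_def)
  then show "\<exists>f. rat_poly_fun V f \<and> nonzero_on V f \<and> (\<forall>p \<in> vectors_on V. f p \<noteq> 0 \<longrightarrow> Q p)"
    using P by (intro exI[of _ f]) auto
next
  assume "\<exists>f. rat_poly_fun V f \<and> nonzero_on V f \<and> (\<forall>p \<in> vectors_on V. f p \<noteq> 0 \<longrightarrow> Q p)"
  then obtain f where f: "rat_poly_fun V f" "nonzero_on V f" "\<forall>p \<in> vectors_on V. f p \<noteq> 0 \<longrightarrow> Q p"
    by blast
  then show "for_generic V Q"
    unfolding for_generic_def rat_algebraic_set_def
    by (intro exI[of _ "{p \<in> vectors_on V. \<forall>g\<in>{f}. g p = 0}"] conjI exI[of _ "{f}"])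
      (auto simp: nonzero_on_def)
qed

lemma for_genericI:
  assumes "rat_poly_fun V f" "nonzero_on V f" "\<And>p. p \<in> vectors_on V \<Longrightarrow> f p \<noteq> 0 \<Longrightarrow> Q p"
  shows "for_generic V Q"
  using assms by (auto simp: for_generic_iff)

lemma for_generic_True: "for_generic V (\<lambda>p. True)"
  by (rule for_genericI[of V "\<lambda>p. 1"])
    (auto simp: nonzero_on_def vectors_on_def intro: rat_poly_fun.const)

lemma for_generic_mono:
  assumes "for_generic V Q" "\<And>p. p \<in> vectors_on V \<Longrightarrow> Q p \<Longrightarrow> Q' p"
  shows "for_generic V Q'"
  using assms by (auto simp: for_generic_iff)

lemma for_generic_conj:
  assumes "for_generic V Q" "for_generic V Q'"
  shows "for_generic V (\<lambda>p. Q p \<and> Q' p)"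
proof -
  obtain f where f: "rat_poly_fun V f" "nonzero_on V f" "\<forall>p \<in> vectors_on V. f p \<noteq> 0 \<longrightarrow> Q p"
    using assms(1) by (auto simp: for_generic_iff)
  obtain g where g: "rat_poly_fun V g" "nonzero_on V g" "\<forall>p \<in> vectors_on V. g p \<noteq> 0 \<longrightarrow> Q' p"
    using assms(2) by (auto simp: for_generic_iff)
  show ?thesis
    using f g nonzero_on_mult[OF f(1,2) g(1,2)]
    by (intro for_genericI[of V "\<lambda>p. f p * g p"]) (auto intro: rat_poly_fun.mult)
qed

lemma for_generic_ball:
  assumes "finite S" "\<And>s. s \<in> S \<Longrightarrow> for_generic V (Q s)"
  shows "for_generic V (\<lambda>p. \<forall>s\<in>S. Q s p)"
  using assms by (induction S) (auto simp: for_generic_True intro: for_generic_conj)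

lemma restrict_config_in_vectors_on: "restrict_config W p \<in> vectors_on W"
  by (simp add: restrict_config_def vectors_on_def)

lemma for_generic_restrict:
  assumes "for_generic W Q" "W \<subseteq> V"
  shows "for_generic V (\<lambda>p. Q (restrict_config W p))"
proof -
  obtain f where f: "rat_poly_fun W f" "nonzero_on W f" "\<forall>p \<in> vectors_on W. f p \<noteq> 0 \<longrightarrow> Q p"
    using assms(1) by (auto simp: for_generic_iff)
  have "nonzero_on V f"
    using f(2) assms(2) by (auto simp: nonzero_on_def vectors_on_def)
  moreover have "Q (restrict_config W p)" if "f p \<noteq> 0" for p
  proof -
    have "f (restrict_config W p) = f p"
      by (rule rat_poly_fun_cong_on[OF f(1)]) (simp add: restrict_config_def)
    with that f(3) show ?thesis using restrict_config_in_vectors_on by metis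
  qed
  ultimately show ?thesis
    by (intro for_genericI[of V f] rat_poly_fun_mono[OF f(1) assms(2)])
qed


section \<open>Elimination with polynomial vectors\<close>

text \<open>
  A division-free Gram--Schmidt process: up to the factor \<open>\<alpha>\<close>, the vector \<open>X\<close> is the component of \<open>g\<close>
  orthogonal to the \<open>w e\<close>. Its coordinates are polynomial in the configuration, which turns rank
  conditions into polynomial conditions. A new vector \<open>w b\<close> whose orthogonal component \<open>Y\<close> vanishes
  identically already lies in the generic span; otherwise \<open>Y\<close> is subtracted from \<open>X\<close> after
  cross-multiplication.
\<close>

lemma generic_orthogonal_component:
  fixes w :: "'e \<Rightarrow> ('v \<Rightarrow> real^'d) \<Rightarrow> 'i \<Rightarrow> real"
  assumes "finite E" "finite I"
    and "\<And>e i. e \<in> E \<Longrightarrow> i \<in> I \<Longrightarrow> rat_poly_fun V (\<lambda>p. w e p i)"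
    and "\<And>i. i \<in> I \<Longrightarrow> rat_poly_fun V (\<lambda>p. g p i)"
  shows "\<exists>f X. rat_poly_fun V f \<and> nonzero_on V f \<and> (\<forall>i\<in>I. rat_poly_fun V (\<lambda>p. X p i)) \<and>
    (\<forall>p\<in>vectors_on V. f p \<noteq> 0 \<longrightarrow> (\<forall>e\<in>E. (\<Sum>i\<in>I. X p i * w e p i) = 0) \<and>
       (\<exists>\<alpha> a. \<alpha> \<noteq> 0 \<and> (\<forall>i\<in>I. X p i = \<alpha> * g p i + (\<Sum>e\<in>E. a e * w e p i))))"
  using assms(1,3,4)
proof (induction E arbitrary: g rule: finite_induct)
  case empty
  show ?case
    by (rule exI[of _ "\<lambda>p. 1"], rule exI[of _ g])
      (use empty in \<open>auto intro!: rat_poly_fun.const exI[of _ 1]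
        simp: nonzero_on_def vectors_on_def\<close>)
next
  case (insert b E)
  define ip where "ip = (\<lambda>x y :: 'i \<Rightarrow> real. \<Sum>i\<in>I. x i * y i)"
  have "\<exists>f X. rat_poly_fun V f \<and> nonzero_on V f \<and> (\<forall>i\<in>I. rat_poly_fun V (\<lambda>p. X p i)) \<and>
    (\<forall>p\<in>vectors_on V. f p \<noteq> 0 \<longrightarrow> (\<forall>e\<in>E. (\<Sum>i\<in>I. X p i * w e p i) = 0) \<and>
       (\<exists>\<alpha> a. \<alpha> \<noteq> 0 \<and> (\<forall>i\<in>I. X p i = \<alpha> * w b p i + (\<Sum>e\<in>E. a e * w e p i))))"
    using insert by (intro insert.IH) auto
  then obtain f1 Y where Y: "rat_poly_fun V f1" "nonzero_on V f1"
      "\<And>i. i \<in> I \<Longrightarrow> rat_poly_fun V (\<lambda>p. Y p i)"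
    and Yo: "\<And>p e. p\<in>vectors_on V \<Longrightarrow> f1 p \<noteq> 0 \<Longrightarrow> e\<in>E \<Longrightarrow> ip (Y p) (w e p) = 0"
    and Ya: "\<And>p. p\<in>vectors_on V \<Longrightarrow> f1 p \<noteq> 0 \<Longrightarrow>
       (\<exists>\<alpha> a. \<alpha> \<noteq> 0 \<and> (\<forall>i\<in>I. Y p i = \<alpha> * w b p i + (\<Sum>e\<in>E. a e * w e p i)))"
    unfolding ip_def by blast
  have "\<exists>f X. rat_poly_fun V f \<and> nonzero_on V f \<and> (\<forall>i\<in>I. rat_poly_fun V (\<lambda>p. X p i)) \<and>
    (\<forall>p\<in>vectors_on V. f p \<noteq> 0 \<longrightarrow> (\<forall>e\<in>E. (\<Sum>i\<in>I. X p i * w e p i) = 0) \<and>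
       (\<exists>\<alpha> a. \<alpha> \<noteq> 0 \<and> (\<forall>i\<in>I. X p i = \<alpha> * g p i + (\<Sum>e\<in>E. a e * w e p i))))"
    using insert by (intro insert.IH) auto
  then obtain f2 X where X: "rat_poly_fun V f2" "nonzero_on V f2"
      "\<And>i. i \<in> I \<Longrightarrow> rat_poly_fun V (\<lambda>p. X p i)"
    and Xo: "\<And>p e. p\<in>vectors_on V \<Longrightarrow> f2 p \<noteq> 0 \<Longrightarrow> e\<in>E \<Longrightarrow> ip (X p) (w e p) = 0"
    and Xa: "\<And>p. p\<in>vectors_on V \<Longrightarrow> f2 p \<noteq> 0 \<Longrightarrow>
       (\<exists>\<alpha> a. \<alpha> \<noteq> 0 \<and> (\<forall>i\<in>I. X p i = \<alpha> * g p i + (\<Sum>e\<in>E. a e * w e p i)))"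
    unfolding ip_def by blast
  have f12: "rat_poly_fun V (\<lambda>p. f1 p * f2 p)" "nonzero_on V (\<lambda>p. f1 p * f2 p)"
    using X Y by (auto intro: rat_poly_fun.mult nonzero_on_mult)
  have ip_poly: "rat_poly_fun V (\<lambda>p. ip (A p) (B p))"
    if "\<And>i. i \<in> I \<Longrightarrow> rat_poly_fun V (\<lambda>p. A p i)" "\<And>i. i \<in> I \<Longrightarrow> rat_poly_fun V (\<lambda>p. B p i)" for A B
    unfolding ip_def using that by (intro rat_poly_fun_intros) auto
  define h where "h = (\<lambda>p. ip (Y p) (w b p))"
  have h: "rat_poly_fun V h" unfolding h_def using insert.prems Y by (intro ip_poly) auto
  show ?case
  proof (cases "nonzero_on V h")
    case False
    then have h0: "h p = 0" if "p \<in> vectors_on V" for p using that by (auto simp: nonzero_on_def)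
    have "ip (X p) (w e p) = 0" if p: "p \<in> vectors_on V" "f1 p * f2 p \<noteq> 0" and e: "e \<in> insert b E" for p e
    proof (cases "e = b")
      case True
      obtain \<alpha> a where a: "\<alpha> \<noteq> 0" "\<And>i. i\<in>I \<Longrightarrow> Y p i = \<alpha> * w b p i + (\<Sum>e\<in>E. a e * w e p i)"
        using Ya[of p] p mult_not_zero by blast
      have lin: "ip Z (Y p) = \<alpha> * ip Z (w b p) + (\<Sum>e\<in>E. a e * ip Z (w e p))" for Z
      proof -
        have "ip Z (Y p) = (\<Sum>i\<in>I. Z i * (\<alpha> * w b p i + (\<Sum>e\<in>E. a e * w e p i)))"
          unfolding ip_def by (rule sum.cong) (auto simp: a)
        also have "\<dots> = \<alpha> * ip Z (w b p) + (\<Sum>e\<in>E. a e * ip Z (w e p))"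
          unfolding ip_def
          by (simp add: algebra_simps sum.distrib sum_distrib_left sum_distrib_right)
            (rule sum.swap)
        finally show ?thesis .
      qed
      have "ip (Y p) (Y p) = 0" using p h0[of p] Yo[of p] unfolding lin h_def by simp
      then have "\<forall>i\<in>I. Y p i = 0"
        unfolding ip_def using assms(2) by (subst (asm) sum_nonneg_eq_0_iff) auto
      then have "ip (X p) (Y p) = 0" by (simp add: ip_def)
      then show ?thesis using p a Xo[of p] unfolding lin True by simp
    qed (use e p Xo in auto)
    moreover have "\<exists>\<alpha> a. \<alpha> \<noteq> 0 \<and> (\<forall>i\<in>I. X p i = \<alpha> * g p i + (\<Sum>e\<in>insert b E. a e * w e p i))"
      if p: "p \<in> vectors_on V" "f1 p * f2 p \<noteq> 0" for p
    proof -
      obtain \<alpha> a where "\<alpha> \<noteq> 0" "\<And>i. i\<in>I \<Longrightarrow> X p i = \<alpha> * g p i + (\<Sum>e\<in>E. a e * w e p i)"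
        using Xa[of p] p mult_not_zero by blast
      moreover have "(\<Sum>e\<in>E. (a(b := 0)) e * w e p i) = (\<Sum>e\<in>E. a e * w e p i)" for i
        using insert.hyps by (intro sum.cong) auto
      ultimately show ?thesis using insert.hyps
        by (intro exI[of _ \<alpha>] exI[of _ "a(b := 0)"]) simp
    qed
    ultimately show ?thesis using f12 X(3)
      unfolding ip_def by (intro exI[of _ "\<lambda>p. f1 p * f2 p"] exI[of _ X] conjI ballI impI) auto
  next
    case True
    define k where "k = (\<lambda>p. ip (X p) (w b p))"
    have k: "rat_poly_fun V k" unfolding k_def using insert.prems X by (intro ip_poly) auto
    define f where "f = (\<lambda>p. f1 p * f2 p * h p)"
    define Z where "Z = (\<lambda>p i. h p * X p i - k p * Y p i)"
    have f: "rat_poly_fun V f" "nonzero_on V f"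
      unfolding f_def using f12 h True by (auto intro: rat_poly_fun.mult nonzero_on_mult)
    have Z: "rat_poly_fun V (\<lambda>p. Z p i)" if "i \<in> I" for i
      unfolding Z_def using that X Y h k by (intro rat_poly_fun_intros) auto
    have Zlin: "ip (Z p) y = h p * ip (X p) y - k p * ip (Y p) y" for p y
      unfolding ip_def Z_def by (simp add: sum_subtractf sum_distrib_left algebra_simps)
    have "ip (Z p) (w e p) = 0" if "p \<in> vectors_on V" "f p \<noteq> 0" "e \<in> insert b E" for p e
      using that Xo[of p e] Yo[of p e] unfolding Zlin f_def by (auto simp: h_def k_def)
    moreover have "\<exists>\<alpha> a. \<alpha> \<noteq> 0 \<and> (\<forall>i\<in>I. Z p i = \<alpha> * g p i + (\<Sum>e\<in>insert b E. a e * w e p i))"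
      if p: "p \<in> vectors_on V" "f p \<noteq> 0" for p
    proof -
      have p': "f1 p \<noteq> 0" "f2 p \<noteq> 0" "h p \<noteq> 0" using p by (auto simp: f_def)
      obtain \<alpha> a where a: "\<alpha> \<noteq> 0" "\<And>i. i\<in>I \<Longrightarrow> X p i = \<alpha> * g p i + (\<Sum>e\<in>E. a e * w e p i)"
        using Xa[OF p(1) p'(2)] by blast
      obtain \<beta> c where c: "\<beta> \<noteq> 0" "\<And>i. i\<in>I \<Longrightarrow> Y p i = \<beta> * w b p i + (\<Sum>e\<in>E. c e * w e p i)"
        using Ya[OF p(1) p'(1)] by blast
      define m where "m = (\<lambda>e. if e = b then - k p * \<beta> else h p * a e - k p * c e)"
      have "Z p i = h p * \<alpha> * g p i + (\<Sum>e\<in>insert b E. m e * w e p i)" if i: "i \<in> I" for i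
      proof -
        have "(\<Sum>e\<in>E. m e * w e p i) = (\<Sum>e\<in>E. h p * (a e * w e p i) - k p * (c e * w e p i))"
          using insert.hyps by (intro sum.cong) (auto simp: m_def algebra_simps)
        also have "\<dots> = h p * (\<Sum>e\<in>E. a e * w e p i) - k p * (\<Sum>e\<in>E. c e * w e p i)"
          by (simp add: sum_subtractf sum_distrib_left)
        finally show ?thesis using insert.hyps a c i
          by (simp add: Z_def m_def algebra_simps)
      qed
      then show ?thesis using a p' by (intro exI[of _ "h p * \<alpha>"] exI[of _ m]) auto
    qed
    ultimately show ?thesis using f Z
      unfolding ip_def by (intro exI[of _ f] exI[of _ Z] conjI ballI impI) auto
  qed
qed

text \<open>
  For the orthogonal component \<open>X\<close>, the polynomial \<open>X \<bullet> g\<close> is either non-zero generically or zero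
  everywhere, and in the second case \<open>X\<close> vanishes. Hence a vector in the kernel of all \<open>w e\<close> but not
  of \<open>g\<close>, at a single generic point, forces such a vector at almost every point, depending
  polynomially on it.
\<close>

lemma generic_span_or_kernel:
  fixes w :: "'e \<Rightarrow> ('v \<Rightarrow> real^'d) \<Rightarrow> 'i \<Rightarrow> real"
  assumes "finite E" "finite I"
    and "\<And>e i. e \<in> E \<Longrightarrow> i \<in> I \<Longrightarrow> rat_poly_fun V (\<lambda>p. w e p i)"
    and g: "\<And>i. i \<in> I \<Longrightarrow> rat_poly_fun V (\<lambda>p. g p i)"
  obtains
    (span) "for_generic V (\<lambda>p. \<exists>a. \<forall>i\<in>I. g p i = (\<Sum>e\<in>E. a e * w e p i))"
  | (kernel) f X where "rat_poly_fun V f" "nonzero_on V f"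
      "\<And>i. i \<in> I \<Longrightarrow> rat_poly_fun V (\<lambda>p. X p i)"
      "\<And>p e. p \<in> vectors_on V \<Longrightarrow> f p \<noteq> 0 \<Longrightarrow> e \<in> E \<Longrightarrow> (\<Sum>i\<in>I. X p i * w e p i) = 0"
      "\<And>p. p \<in> vectors_on V \<Longrightarrow> f p \<noteq> 0 \<Longrightarrow> (\<Sum>i\<in>I. X p i * g p i) \<noteq> 0"
proof -
  obtain f X where f: "rat_poly_fun V f" "nonzero_on V f"
    and X: "\<And>i. i\<in>I \<Longrightarrow> rat_poly_fun V (\<lambda>p. X p i)"
    and Xo: "\<And>p e. p\<in>vectors_on V \<Longrightarrow> f p \<noteq> 0 \<Longrightarrow> e\<in>E \<Longrightarrow> (\<Sum>i\<in>I. X p i * w e p i) = 0"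
    and Xa: "\<And>p. p\<in>vectors_on V \<Longrightarrow> f p \<noteq> 0 \<Longrightarrow>
       (\<exists>\<alpha> a. \<alpha> \<noteq> 0 \<and> (\<forall>i\<in>I. X p i = \<alpha> * g p i + (\<Sum>e\<in>E. a e * w e p i)))"
    using generic_orthogonal_component[where w = w and g = g, OF assms] by blast
  define h where "h = (\<lambda>p. \<Sum>i\<in>I. X p i * g p i)"
  have h: "rat_poly_fun V h" unfolding h_def using X g by (intro rat_poly_fun_intros) auto
  show thesis
  proof (cases "nonzero_on V h")
    case True
    show thesis
    proof (rule kernel[of "\<lambda>p. f p * h p" X])
      show "rat_poly_fun V (\<lambda>p. f p * h p)" "nonzero_on V (\<lambda>p. f p * h p)"
        using f h True by (auto intro: rat_poly_fun.mult nonzero_on_mult)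
    qed (use X Xo in \<open>auto simp: h_def\<close>)
  next
    case False
    show thesis
    proof (rule span, rule for_genericI[OF f])
      fix p :: "'v \<Rightarrow> real^'d" assume p: "p \<in> vectors_on V" "f p \<noteq> 0"
      obtain \<alpha> a where a: "\<alpha> \<noteq> 0" "\<And>i. i\<in>I \<Longrightarrow> X p i = \<alpha> * g p i + (\<Sum>e\<in>E. a e * w e p i)"
        using Xa[OF p] by blast
      have "(\<Sum>i\<in>I. X p i * X p i) = (\<Sum>i\<in>I. X p i * (\<alpha> * g p i + (\<Sum>e\<in>E. a e * w e p i)))"
        by (rule sum.cong) (auto simp: a)
      also have "\<dots> = \<alpha> * h p + (\<Sum>e\<in>E. a e * (\<Sum>i\<in>I. X p i * w e p i))"
        unfolding h_def
        by (simp add: algebra_simps sum.distrib sum_distrib_left sum_distrib_right)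
          (rule sum.swap)
      also have "\<dots> = 0" using p Xo False by (auto simp: nonzero_on_def)
      finally have X0: "\<forall>i\<in>I. X p i = 0" using assms(2) by (subst (asm) sum_nonneg_eq_0_iff) auto
      have "g p i = (\<Sum>e\<in>E. (- a e / \<alpha>) * w e p i)" if "i \<in> I" for i
      proof -
        have "\<alpha> * g p i = - (\<Sum>e\<in>E. a e * w e p i)" using a(2)[OF that] X0 that by simp
        then have "g p i = - (\<Sum>e\<in>E. a e * w e p i) / \<alpha>" using a(1) by (simp add: field_simps)
        then show ?thesis by (simp add: sum_negf sum_divide_distrib)
      qed
      then show "\<exists>a. \<forall>i\<in>I. g p i = (\<Sum>e\<in>E. a e * w e p i)"
        by (intro exI[of _ "\<lambda>e. - a e / \<alpha>"]) simp
    qed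
  qed
qed


section \<open>Generic local rigidity implies generic infinitesimal rigidity\<close>

text \<open>
  The entry of \<open>R(p) x\<close> at an arc, defined for all pairs of vertices: half the derivative of the squared
  length of the pair at \<open>p\<close> in the direction \<open>x\<close>.
\<close>

definition stretch :: "('v \<Rightarrow> real^'d) \<Rightarrow> ('v \<Rightarrow> real^'d) \<Rightarrow> 'v \<times> 'v \<Rightarrow> real" where
  "stretch p x = (\<lambda>(i, j). (p i - p j) \<bullet> (x i - x j))"

definition infinitesimally_rigid :: "'v pair_pre_digraph \<Rightarrow> ('v \<Rightarrow> real^'d) \<Rightarrow> bool" where
  "infinitesimally_rigid G p \<longleftrightarrow>
     (\<forall>x. (\<forall>e\<in>parcs G. stretch p x e = 0) \<longrightarrow> (\<forall>e\<in>pverts G \<times> pverts G. stretch p x e = 0))"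

lemma sum_rigidity_matrix:
  assumes "finite V" "i \<in> V" "j \<in> V" "i \<noteq> j"
  shows "(\<Sum>v\<in>V. rigidity_matrix p (i, j) v \<bullet> x v) = stretch p x (i, j)"
proof -
  have "(\<Sum>v\<in>V. rigidity_matrix p (i, j) v \<bullet> x v)
      = (\<Sum>v\<in>V. (if v = i then (p i - p j) \<bullet> x v else 0) + (if v = j then (p j - p i) \<bullet> x v else 0))"
    using assms by (intro sum.cong) (auto simp: rigidity_matrix_def)
  also have "\<dots> = (p i - p j) \<bullet> x i + (p j - p i) \<bullet> x j"
    using assms by (simp add: sum.distrib)
  also have "\<dots> = stretch p x (i, j)"
    by (simp add: stretch_def algebra_simps)
  finally show ?thesis .
qed

lemma rat_poly_fun_rigidity_matrix:
  assumes "i \<in> V" "j \<in> V"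
  shows "rat_poly_fun V (\<lambda>p. rigidity_matrix p (i, j) v $ k)"
proof -
  consider "v = i" | "v \<noteq> i" "v = j" | "v \<noteq> i" "v \<noteq> j" by blast
  then show ?thesis
    by cases (use assms in \<open>auto simp: rigidity_matrix_def intro!: rat_poly_fun_intros\<close>)
qed

lemma compact_config_box:
  fixes p :: "'v \<Rightarrow> real^'d"
  shows "compact {q \<in> vectors_on V. \<forall>v\<in>V. dist (q v) (p v) \<le> r}"
proof -
  have "{q \<in> vectors_on V. \<forall>v\<in>V. dist (q v) (p v) \<le> r} =
      PiE UNIV (\<lambda>v. if v \<in> V then cball (p v) r else {0})"
    by (force simp: vectors_on_def PiE_def Pi_def dist_commute)
  moreover have "compactin (product_topology (\<lambda>_. euclidean) UNIV)
      (PiE UNIV (\<lambda>v. if v \<in> V then cball (p v) r else {0}))"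
    by (subst compactin_PiE) auto
  ultimately show ?thesis
    by (simp add: euclidean_product_topology)
qed

lemma open_contains_config_box:
  fixes p :: "'v \<Rightarrow> real^'d"
  assumes "open U" "p \<in> U" "p \<in> vectors_on V" "finite V" "\<delta> > 0"
  obtains r where "0 < r" "r < \<delta>" "{q \<in> vectors_on V. \<forall>v\<in>V. dist (q v) (p v) \<le> r} \<subseteq> U"
proof -
  have "openin (product_topology (\<lambda>_. euclidean) UNIV) U"
    using assms(1) by (simp add: euclidean_product_topology)
  then obtain X where X: "p \<in> PiE UNIV X" "\<And>i. open (X i)" "PiE UNIV X \<subseteq> U"
    using product_topology_open_contains_basis[of "\<lambda>_. euclidean" UNIV U p] assms(2) by auto
  have "\<exists>r>0. ball (p v) r \<subseteq> X v" for v
    using X(1) X(2)[of v] by (simp add: open_contains_ball PiE_def Pi_def)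
  then obtain r where r: "\<And>v. r v > 0" "\<And>v. ball (p v) (r v) \<subseteq> X v" by metis
  define r0 where "r0 = Min (insert \<delta> (r ` V)) / 2"
  have m: "Min (insert \<delta> (r ` V)) > 0" using assms r by (subst Min_gr_iff) auto
  have m1: "Min (insert \<delta> (r ` V)) \<le> \<delta>" using assms by simp
  have m2: "Min (insert \<delta> (r ` V)) \<le> r v" if "v \<in> V" for v using assms that by simp
  have "q v \<in> X v" if q: "q \<in> vectors_on V" "\<forall>v\<in>V. dist (q v) (p v) \<le> r0" for q v
  proof (cases "v \<in> V")
    case True
    then have "dist (p v) (q v) < r v"
      using q m m2[OF True] unfolding r0_def by (fastforce simp: dist_commute)
    then show ?thesis using r(2)[of v] by auto
  next
    case False
    then have "q v = p v" using q assms(3) by (simp add: vectors_on_def)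
    then show ?thesis using X(1) by (auto simp: PiE_def)
  qed
  then have "{q \<in> vectors_on V. \<forall>v\<in>V. dist (q v) (p v) \<le> r0} \<subseteq> U" using X(3) by auto
  moreover have "0 < r0" "r0 < \<delta>" using m m1 by (auto simp: r0_def)
  ultimately show thesis using that by blast
qed

text \<open>
  Euler polygons along \<open>Y\<close> change the squared lengths of the pairs in \<open>E\<close> only to second order in the
  step size, while the length of \<open>(i, j)\<close> grows at a positive rate. Minimising the total change over
  a compact box gives a configuration in which the pairs in \<open>E\<close> keep their lengths and \<open>(i, j)\<close> does
  not.
\<close>

lemma lengthening_flow:
  fixes p0 :: "'v \<Rightarrow> real^'d" and Y :: "('v \<Rightarrow> real^'d) \<Rightarrow> 'v \<Rightarrow> real^'d"
  assumes V: "finite V" and E: "finite E" "E \<subseteq> V \<times> V" and ij: "i \<in> V" "j \<in> V"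
    and p0: "p0 \<in> vectors_on V" "p0 \<in> U" "open U"
    and Y: "\<And>v. v \<in> V \<Longrightarrow> continuous_on UNIV (\<lambda>p. Y p v)"
    and YE: "\<And>p e. p \<in> vectors_on V \<Longrightarrow> p \<in> U \<Longrightarrow> e \<in> E \<Longrightarrow> stretch p (Y p) e = 0"
    and Yij: "\<And>p. p \<in> vectors_on V \<Longrightarrow> p \<in> U \<Longrightarrow> stretch p (Y p) (i, j) > 0"
    and "\<delta> > 0"
  shows "\<exists>q\<in>vectors_on V. (\<forall>v\<in>V. dist (q v) (p0 v) < \<delta>) \<and>
    (\<forall>(a, b)\<in>E. norm (q a - q b) = norm (p0 a - p0 b)) \<and> norm (p0 i - p0 j) < norm (q i - q j)"
proof -
  obtain r where r: "0 < r" "r < \<delta>" "{q \<in> vectors_on V. \<forall>v\<in>V. dist (q v) (p0 v) \<le> r} \<subseteq> U"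
    using open_contains_config_box[OF p0(3,2,1) V \<open>\<delta> > 0\<close>] by blast
  define B where "B = {q \<in> vectors_on V. \<forall>v\<in>V. dist (q v) (p0 v) \<le> r}"
  have B: "compact B" unfolding B_def by (rule compact_config_box)
  have p0B: "p0 \<in> B" using p0 r by (simp add: B_def)
  have BU: "B \<subseteq> U" "B \<subseteq> vectors_on V" using r by (auto simp: B_def)
  have cont: "continuous_on UNIV (\<lambda>q. q v)" for v :: 'v
    by (rule continuous_on_product_coordinates)
  have contc: "continuous_on A (\<lambda>q. q v)" for A and v :: 'v
    using continuous_on_subset[OF cont] by blast
  have contY: "continuous_on B (\<lambda>q. Y q v)" if "v \<in> V" for v
    using continuous_on_subset[OF Y[OF that]] by blast
  obtain c where c: "c > 0" "\<And>q. q \<in> B \<Longrightarrow> c \<le> stretch q (Y q) (i, j)"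
  proof -
    have "continuous_on B (\<lambda>q. stretch q (Y q) (i, j))"
      unfolding stretch_def using contc contY ij by (auto intro!: continuous_intros)
    then obtain z where "z \<in> B" "\<forall>q\<in>B. stretch z (Y z) (i, j) \<le> stretch q (Y q) (i, j)"
      using continuous_attains_inf[OF B] p0B by blast
    then show thesis using Yij[of z] BU by (intro that[of "stretch z (Y z) (i, j)"]) auto
  qed
  obtain C where C: "C > 0" "\<And>q v. q \<in> B \<Longrightarrow> v \<in> V \<Longrightarrow> norm (Y q v) \<le> C"
  proof -
    have "continuous_on B (\<lambda>q. \<Sum>v\<in>V. norm (Y q v))"
      using contY by (auto intro!: continuous_intros)
    then obtain z where z: "z \<in> B" "\<forall>q\<in>B. (\<Sum>v\<in>V. norm (Y q v)) \<le> (\<Sum>v\<in>V. norm (Y z v))"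
      using continuous_attains_sup[OF B] p0B by blast
    have "norm (Y q v) \<le> (\<Sum>v\<in>V. norm (Y z v)) + 1" if "q \<in> B" "v \<in> V" for q v
      using member_le_sum[of v V "\<lambda>v. norm (Y q v)"] V that z by fastforce
    moreover have "0 \<le> (\<Sum>v\<in>V. norm (Y z v))" by (simp add: sum_nonneg)
    ultimately show thesis
      by (intro that[of "(\<Sum>v\<in>V. norm (Y z v)) + 1"]) auto
  qed
  define T where "T = r / C"
  have T: "T > 0" "T * C = r" using r C by (auto simp: T_def)
  define B' where "B' = B \<inter> {q. (norm (p0 i - p0 j))\<^sup>2 + 2 * T * c \<le> (norm (q i - q j))\<^sup>2}"
  define \<phi> where "\<phi> = (\<lambda>q :: 'v \<Rightarrow> real^'d. \<Sum>(a, b)\<in>E. \<bar>(norm (q a - q b))\<^sup>2 - (norm (p0 a - p0 b))\<^sup>2\<bar>)"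
  have euler: "\<exists>q\<in>B'. \<phi> q \<le> real (card E) * (4 * C\<^sup>2 * T\<^sup>2) / N" if N: "N \<ge> 1" for N :: nat
  proof -
    define h where "h = T / N"
    have h: "h > 0" "N * h = T" using N T by (auto simp: h_def)
    define q where "q = rec_nat p0 (\<lambda>_ q v. if v \<in> V then q v + h *\<^sub>R Y q v else 0)"
    have q0: "q 0 = p0" by (simp add: q_def)
    have qS: "q (Suc k) = (\<lambda>v. if v \<in> V then q k v + h *\<^sub>R Y (q k) v else 0)" for k
      unfolding q_def by simp
    have step: "(norm (q (Suc k) a - q (Suc k) b))\<^sup>2 = (norm (q k a - q k b))\<^sup>2
        + 2 * h * stretch (q k) (Y (q k)) (a, b) + h\<^sup>2 * (norm (Y (q k) a - Y (q k) b))\<^sup>2"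
      if "a \<in> V" "b \<in> V" for a b k
    proof -
      have "q (Suc k) a - q (Suc k) b = (q k a - q k b) + h *\<^sub>R (Y (q k) a - Y (q k) b)"
        using that by (simp add: qS algebra_simps)
      then show ?thesis
        by (simp only: power2_norm_eq_inner)
          (simp add: inner_add_left inner_add_right stretch_def inner_commute algebra_simps power2_eq_square)
    qed
    have main: "k \<le> N \<Longrightarrow> q k \<in> vectors_on V \<and> (\<forall>v\<in>V. dist (q k v) (p0 v) \<le> k * h * C) \<and>
      (\<forall>(a, b)\<in>E. \<bar>(norm (q k a - q k b))\<^sup>2 - (norm (p0 a - p0 b))\<^sup>2\<bar> \<le> k * (h\<^sup>2 * (2 * C)\<^sup>2)) \<and>
      (norm (p0 i - p0 j))\<^sup>2 + 2 * (k * h) * c \<le> (norm (q k i - q k j))\<^sup>2" for k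
    proof (induction k)
      case 0
      show ?case using p0 by (auto simp: q0)
    next
      case (Suc k)
      then have IH: "q k \<in> vectors_on V" "\<forall>v\<in>V. dist (q k v) (p0 v) \<le> k * h * C"
        "\<And>a b. (a, b) \<in> E \<Longrightarrow> \<bar>(norm (q k a - q k b))\<^sup>2 - (norm (p0 a - p0 b))\<^sup>2\<bar> \<le> k * (h\<^sup>2 * (2 * C)\<^sup>2)"
        "(norm (p0 i - p0 j))\<^sup>2 + 2 * (k * h) * c \<le> (norm (q k i - q k j))\<^sup>2"
        by auto
      have "real k * h * C \<le> r"
      proof -
        have "real k * h \<le> real N * h" using Suc.prems h by (intro mult_right_mono) auto
        then have "real k * h * C \<le> T * C" using h C by (intro mult_right_mono) auto
        then show ?thesis using T by simp
      qed
      then have qB: "q k \<in> B" using IH by (force simp: B_def)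
      have "dist (q (Suc k) v) (p0 v) \<le> real (Suc k) * h * C" if "v \<in> V" for v
      proof -
        have "q (Suc k) v - p0 v = (q k v - p0 v) + h *\<^sub>R Y (q k) v" using that by (simp add: qS)
        then have "norm (q (Suc k) v - p0 v) \<le> norm (q k v - p0 v) + norm (h *\<^sub>R Y (q k) v)"
          by (simp only: norm_triangle_ineq)
        moreover have "norm (h *\<^sub>R Y (q k) v) \<le> h * C"
          using h C(2)[OF qB that] by (simp add: mult_left_mono)
        ultimately show ?thesis using IH(2) that by (fastforce simp: dist_norm algebra_simps)
      qed
      moreover have "\<bar>(norm (q (Suc k) a - q (Suc k) b))\<^sup>2 - (norm (p0 a - p0 b))\<^sup>2\<bar>
          \<le> real (Suc k) * (h\<^sup>2 * (2 * C)\<^sup>2)" if ab: "(a, b) \<in> E" for a b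
      proof -
        have V: "a \<in> V" "b \<in> V" using ab E by auto
        have "norm (Y (q k) a - Y (q k) b) \<le> 2 * C"
          using norm_triangle_ineq4[of "Y (q k) a" "Y (q k) b"] C(2)[OF qB V(1)] C(2)[OF qB V(2)] by simp
        then have "(norm (Y (q k) a - Y (q k) b))\<^sup>2 \<le> (2 * C)\<^sup>2" by (intro power_mono) auto
        then have 1: "h\<^sup>2 * (norm (Y (q k) a - Y (q k) b))\<^sup>2 \<le> h\<^sup>2 * (2 * C)\<^sup>2"
          by (intro mult_left_mono) auto
        have 2: "0 \<le> h\<^sup>2 * (norm (Y (q k) a - Y (q k) b))\<^sup>2" by simp
        have "stretch (q k) (Y (q k)) (a, b) = 0" using YE ab qB BU by blast
        then have 3: "(norm (q (Suc k) a - q (Suc k) b))\<^sup>2 =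
            (norm (q k a - q k b))\<^sup>2 + h\<^sup>2 * (norm (Y (q k) a - Y (q k) b))\<^sup>2"
          using step[OF V] by simp
        have "real (Suc k) * (h\<^sup>2 * (2 * C)\<^sup>2) = real k * (h\<^sup>2 * (2 * C)\<^sup>2) + h\<^sup>2 * (2 * C)\<^sup>2"
          by (simp add: algebra_simps)
        then show ?thesis using IH(3)[OF ab] 1 2 3 by linarith
      qed
      moreover have "(norm (p0 i - p0 j))\<^sup>2 + 2 * (real (Suc k) * h) * c \<le> (norm (q (Suc k) i - q (Suc k) j))\<^sup>2"
      proof -
        have "2 * h * c \<le> 2 * h * stretch (q k) (Y (q k)) (i, j)"
          using c(2)[OF qB] h by simp
        moreover have "0 \<le> h\<^sup>2 * (norm (Y (q k) i - Y (q k) j))\<^sup>2" by simp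
        moreover have "2 * (real (Suc k) * h) * c = 2 * (real k * h) * c + 2 * h * c"
          by (simp add: algebra_simps)
        ultimately show ?thesis using step[OF ij, of k] IH(4) by linarith
      qed
      moreover have "q (Suc k) \<in> vectors_on V" by (simp add: qS vectors_on_def)
      ultimately show ?case by blast
    qed
    have "real N * h * C = r" using h T by simp
    then have qN: "q N \<in> B'" using main[of N] h unfolding B'_def B_def by force
    have "\<phi> (q N) \<le> (\<Sum>e\<in>E. real N * (h\<^sup>2 * (2 * C)\<^sup>2))"
      unfolding \<phi>_def using main[of N] by (intro sum_mono) auto
    also have "\<dots> = real (card E) * (4 * C\<^sup>2 * T\<^sup>2) / N"
      using N by (simp add: h_def power2_eq_square field_simps)
    finally show ?thesis using qN by blast
  qed
  have "compact B'"
    unfolding B'_def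
  proof (rule compact_Int_closed[OF B])
    show "closed {q :: 'v \<Rightarrow> real^'d. (norm (p0 i - p0 j))\<^sup>2 + 2 * T * c \<le> (norm (q i - q j))\<^sup>2}"
      using cont by (intro closed_Collect_le continuous_intros)
  qed
  moreover have "B' \<noteq> {}" using euler[of 1] by auto
  moreover have "continuous_on B' \<phi>"
    unfolding \<phi>_def case_prod_unfold by (intro continuous_intros contc)
  ultimately obtain q where q: "q \<in> B'" "\<forall>z\<in>B'. \<phi> q \<le> \<phi> z"
    using continuous_attains_inf by blast
  have \<phi>0: "\<phi> z \<ge> 0" for z unfolding \<phi>_def by (intro sum_nonneg) auto
  have "\<phi> q = 0"
  proof (rule ccontr)
    assume "\<phi> q \<noteq> 0"
    then have pos: "\<phi> q > 0" using \<phi>0[of q] by simp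
    define K where "K = real (card E) * (4 * C\<^sup>2 * T\<^sup>2)"
    obtain n where n: "K < real n * \<phi> q" using ex_less_of_nat_mult[OF pos] by blast
    have "K \<ge> 0" by (simp add: K_def)
    then have n1: "n \<ge> 1" using n by (cases n) auto
    have "\<phi> q \<le> K / n" using euler[OF n1] q by (force simp: K_def)
    then show False using n n1 by (simp add: field_simps)
  qed
  then have "\<forall>e\<in>E. (case e of (a, b) \<Rightarrow> \<bar>(norm (q a - q b))\<^sup>2 - (norm (p0 a - p0 b))\<^sup>2\<bar>) = 0"
    unfolding \<phi>_def using E by (subst (asm) sum_nonneg_eq_0_iff) auto
  then have "\<forall>(a, b)\<in>E. norm (q a - q b) = norm (p0 a - p0 b)" by auto
  moreover have "norm (p0 i - p0 j) < norm (q i - q j)"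
  proof (rule power2_less_imp_less)
    show "(norm (p0 i - p0 j))\<^sup>2 < (norm (q i - q j))\<^sup>2"
      using q(1) mult_pos_pos[OF T(1) c(1)] unfolding B'_def by auto
  qed simp
  moreover have "q \<in> vectors_on V" "\<forall>v\<in>V. dist (q v) (p0 v) < \<delta>"
    using q(1) r unfolding B'_def B_def by auto
  ultimately show ?thesis by blast
qed

text \<open>
  A generic form of the theorem of Asimow and Roth. If a pair of vertices can be stretched by an
  infinitesimal flex at one generic configuration, then elimination yields a polynomial field of
  flexes stretching it, and following this field contradicts local rigidity.
\<close>

lemma generically_rigid_imp_infinitesimally_rigid:
  fixes G :: "'v pair_pre_digraph"
  assumes G: "pair_digraph G" and rigid: "generically_rigid TYPE('d::finite) G"
  shows "for_generic (pverts G) (\<lambda>p :: 'v \<Rightarrow> real^'d. infinitesimally_rigid G p)"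
proof -
  interpret pair_digraph G by fact
  define V where "V = pverts G"
  have V: "finite V" and E: "finite (parcs G)" "parcs G \<subseteq> V \<times> V"
    using pair_finite_verts pair_finite_arcs arc_fst_in_verts arc_snd_in_verts by (force simp: V_def)+
  have coords: "(\<Sum>vk\<in>V \<times> UNIV. (y (fst vk) $ snd vk) * (x (fst vk) $ snd vk)) = (\<Sum>v\<in>V. y v \<bullet> x v)"
    for x y :: "'v \<Rightarrow> real^'d"
    by (simp add: sum.cartesian_product' inner_vec_def)
  have E_sum: "(\<Sum>v\<in>V. rigidity_matrix p e v \<bullet> x v) = stretch p x e" if "e \<in> parcs G" for p x :: "'v \<Rightarrow> real^'d" and e
    using sum_rigidity_matrix[OF V, of "fst e" "snd e" p x] E that pair_no_loops[of e] by force
  have pair: "for_generic V (\<lambda>p :: 'v \<Rightarrow> real^'d.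
      \<forall>x. (\<forall>e\<in>parcs G. stretch p x e = 0) \<longrightarrow> stretch p x (i, j) = 0)"
    if ij: "i \<in> V" "j \<in> V" "i \<noteq> j" for i j
  proof -
    define w where "w = (\<lambda>e (p :: 'v \<Rightarrow> real^'d) (vk :: 'v \<times> 'd). rigidity_matrix p e (fst vk) $ snd vk)"
    have wpoly: "rat_poly_fun V (\<lambda>p. w e p vk)" if "e \<in> parcs G" for e vk
      using rat_poly_fun_rigidity_matrix[of "fst e" V "snd e"] that E by (force simp: w_def)
    have gpoly: "rat_poly_fun V (\<lambda>p. w (i, j) p vk)" for vk
      using rat_poly_fun_rigidity_matrix[of i V j] ij by (simp add: w_def)
    have I: "finite (V \<times> (UNIV :: 'd set))" using V by simp
    show ?thesis
    proof (rule generic_span_or_kernel[of "parcs G" "V \<times> (UNIV :: 'd set)" V w "w (i, j)"])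
      assume "for_generic V (\<lambda>p. \<exists>a. \<forall>vk\<in>V \<times> UNIV. w (i, j) p vk = (\<Sum>e\<in>parcs G. a e * w e p vk))"
      then show ?thesis
      proof (rule for_generic_mono, intro allI impI)
        fix p x :: "'v \<Rightarrow> real^'d"
        assume "\<exists>a. \<forall>vk\<in>V \<times> UNIV. w (i, j) p vk = (\<Sum>e\<in>parcs G. a e * w e p vk)"
          and x: "\<forall>e\<in>parcs G. stretch p x e = 0"
        then obtain a where a: "\<And>vk. vk \<in> V \<times> UNIV \<Longrightarrow> w (i, j) p vk = (\<Sum>e\<in>parcs G. a e * w e p vk)"
          by blast
        have "stretch p x (i, j) = (\<Sum>vk\<in>V \<times> UNIV. w (i, j) p vk * (x (fst vk) $ snd vk))"
          by (simp add: w_def coords sum_rigidity_matrix[OF V ij])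
        also have "\<dots> = (\<Sum>vk\<in>V \<times> UNIV. (\<Sum>e\<in>parcs G. a e * w e p vk) * (x (fst vk) $ snd vk))"
          by (rule sum.cong) (auto simp: a)
        also have "\<dots> = (\<Sum>e\<in>parcs G. a e * (\<Sum>vk\<in>V \<times> UNIV. w e p vk * (x (fst vk) $ snd vk)))"
          by (subst sum_distrib_left, subst sum.swap) (simp add: sum_distrib_right mult.assoc)
        also have "\<dots> = (\<Sum>e\<in>parcs G. a e * stretch p x e)"
          by (intro sum.cong refl) (simp only: w_def coords E_sum)
        also have "\<dots> = 0" using x by simp
        finally show "stretch p x (i, j) = 0" .
      qed
    next
      fix f :: "('v \<Rightarrow> real^'d) \<Rightarrow> real" and X
      assume f: "rat_poly_fun V f" "nonzero_on V f"
        and Xpoly: "\<And>vk. vk \<in> V \<times> UNIV \<Longrightarrow> rat_poly_fun V (\<lambda>p. X p vk)"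
        and XE: "\<And>p e. p \<in> vectors_on V \<Longrightarrow> f p \<noteq> 0 \<Longrightarrow> e \<in> parcs G \<Longrightarrow>
           (\<Sum>vk\<in>V \<times> UNIV. X p vk * w e p vk) = 0"
        and Xij: "\<And>p. p \<in> vectors_on V \<Longrightarrow> f p \<noteq> 0 \<Longrightarrow>
           (\<Sum>vk\<in>V \<times> UNIV. X p vk * w (i, j) p vk) \<noteq> 0"
      obtain g where g: "rat_poly_fun V g" "nonzero_on V g"
          "\<And>p :: 'v \<Rightarrow> real^'d. p \<in> vectors_on V \<Longrightarrow> g p \<noteq> 0 \<Longrightarrow> locally_rigid G p"
        using rigid unfolding generically_rigid_def for_generic_iff V_def by blast
      obtain p0 where p0: "p0 \<in> vectors_on V" "f p0 \<noteq> 0" "g p0 \<noteq> 0"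
        using nonzero_on_mult[OF f g(1,2)] by (auto simp: nonzero_on_def)
      obtain \<epsilon> where \<epsilon>: "\<epsilon> > 0" "\<And>q. q \<in> vectors_on V \<Longrightarrow> \<forall>v\<in>V. dist (q v) (p0 v) < \<epsilon> \<Longrightarrow>
          distance_map G q = distance_map G p0 \<Longrightarrow> congruent_on V p0 q"
        using g(3)[OF p0(1,3)] unfolding locally_rigid_def V_def by blast
      define s where "s = (\<lambda>p. \<Sum>vk\<in>V \<times> UNIV. X p vk * w (i, j) p vk)"
      define Y where "Y = (\<lambda>p v. \<chi> k. s p * X p (v, k))"
      have Ysum: "(\<Sum>v\<in>V. rigidity_matrix p e v \<bullet> Y p v) = s p * (\<Sum>vk\<in>V \<times> UNIV. X p vk * w e p vk)" for p e
        unfolding coords[symmetric] by (simp add: Y_def w_def sum_distrib_left mult_ac)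
      have s: "rat_poly_fun V s"
        unfolding s_def using Xpoly gpoly by (intro rat_poly_fun_intros) auto
      have "\<exists>q\<in>vectors_on V. (\<forall>v\<in>V. dist (q v) (p0 v) < \<epsilon>) \<and>
          (\<forall>(a, b)\<in>parcs G. norm (q a - q b) = norm (p0 a - p0 b)) \<and> norm (p0 i - p0 j) < norm (q i - q j)"
      proof (rule lengthening_flow[OF V E ij(1,2) p0(1), where U = "{p. f p \<noteq> 0}" and Y = Y])
        show "p0 \<in> {p. f p \<noteq> 0}" using p0 by simp
        show "open {p. f p \<noteq> 0}"
          using rat_poly_fun_continuous[OF f(1)] by (intro open_Collect_neq continuous_intros)
        show "continuous_on UNIV (\<lambda>p. Y p v)" if "v \<in> V" for v
          unfolding Y_def using that Xpoly s
          by (intro continuous_on_vec_lambda rat_poly_fun_continuous[of V] rat_poly_fun.mult) auto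
        show "stretch p (Y p) e = 0" if "p \<in> vectors_on V" "p \<in> {p. f p \<noteq> 0}" "e \<in> parcs G" for p e
          using XE[of p e] that Ysum[where p = p and e = e] E_sum[of e p "Y p"] by simp
        show "stretch p (Y p) (i, j) > 0" if "p \<in> vectors_on V" "p \<in> {p. f p \<noteq> 0}" for p
        proof -
          have "stretch p (Y p) (i, j) = s p * s p"
            using Ysum[where p = p and e = "(i, j)"]
            unfolding sum_rigidity_matrix[OF V ij] s_def .
          then show ?thesis using Xij[of p] that by (auto simp: s_def zero_less_mult_iff linorder_neq_iff)
        qed
      qed (use \<epsilon> in auto)
      then obtain q where q: "q\<in>vectors_on V" "\<forall>v\<in>V. dist (q v) (p0 v) < \<epsilon>"
          "\<forall>(a, b)\<in>parcs G. norm (q a - q b) = norm (p0 a - p0 b)" "norm (p0 i - p0 j) < norm (q i - q j)"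
        by blast
      have "distance_map G q = distance_map G p0"
        using q(3) by (force simp: distance_map_def fun_eq_iff norm_minus_commute)
      then have "congruent_on V p0 q" using \<epsilon> q by blast
      then have "norm (q i - q j) = norm (p0 i - p0 j)"
        using ij by (auto simp: congruent_on_def simp flip: dist_norm)
      then show ?thesis using q(4) by simp
    qed (use V E I wpoly gpoly in auto)
  qed
  have "for_generic V (\<lambda>p :: 'v \<Rightarrow> real^'d.
      \<forall>e\<in>V \<times> V. \<forall>x. (\<forall>e\<in>parcs G. stretch p x e = 0) \<longrightarrow> stretch p x e = 0)"
  proof (rule for_generic_ball)
    show "for_generic V (\<lambda>p :: 'v \<Rightarrow> real^'d. \<forall>x. (\<forall>e\<in>parcs G. stretch p x e = 0) \<longrightarrow> stretch p x e = 0)"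
      if "e \<in> V \<times> V" for e
    proof (cases "fst e = snd e")
      case True
      then have "stretch p x e = 0" for p x :: "'v \<Rightarrow> real^'d"
        by (cases e) (simp add: stretch_def)
      then show ?thesis by (simp add: for_generic_True)
    qed (use pair[of "fst e" "snd e"] that in auto)
  qed (use V in simp)
  then show ?thesis
    unfolding V_def by (rule for_generic_mono) (auto simp: infinitesimally_rigid_def)
qed


section \<open>Eigenvectors in invariant subspaces\<close>

lemma nontrivial_linear_relation:
  fixes w :: "'k \<Rightarrow> 'i \<Rightarrow> 'a::field"
  assumes "finite I" "finite K" "card I < card K"
  shows "\<exists>c. (\<exists>k\<in>K. c k \<noteq> 0) \<and> (\<forall>i\<in>I. (\<Sum>k\<in>K. c k * w k i) = 0)"
  using assms
proof (induction I arbitrary: K w rule: finite_induct)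
  case empty
  then obtain k where "k \<in> K" by (metis card.empty equals0I less_irrefl)
  then show ?case by (intro exI[of _ "\<lambda>_. 1"]) auto
next
  case (insert i I)
  show ?case
  proof (cases "\<forall>k\<in>K. w k i = 0")
    case True
    have "card I < card K" using insert by simp
    then obtain c where "\<exists>k\<in>K. c k \<noteq> 0" "\<forall>i\<in>I. (\<Sum>k\<in>K. c k * w k i) = 0"
      using insert.IH[of K w] insert.prems by blast
    then show ?thesis using True by (intro exI[of _ c]) auto
  next
    case False
    then obtain k0 where k0: "k0 \<in> K" "w k0 i \<noteq> 0" by blast
    define u where "u = (\<lambda>k j. w k j - (w k i / w k0 i) * w k0 j)"
    have "card I < card (K - {k0})" using insert k0 by simp
    then obtain c where c: "\<exists>k\<in>K - {k0}. c k \<noteq> 0" "\<forall>j\<in>I. (\<Sum>k\<in>K - {k0}. c k * u k j) = 0"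
      using insert.IH[of "K - {k0}" u] insert.prems by blast
    define c' where "c' = (\<lambda>k. if k = k0 then - (\<Sum>k\<in>K - {k0}. c k * (w k i / w k0 i)) else c k)"
    have rel: "(\<Sum>k\<in>K. c' k * w k j) = (\<Sum>k\<in>K - {k0}. c k * u k j)" for j
    proof -
      have "(\<Sum>k\<in>K. c' k * w k j) = c' k0 * w k0 j + (\<Sum>k\<in>K - {k0}. c' k * w k j)"
        using insert.prems k0 by (simp add: sum.remove)
      also have "(\<Sum>k\<in>K - {k0}. c' k * w k j) = (\<Sum>k\<in>K - {k0}. c k * w k j)"
        by (rule sum.cong) (auto simp: c'_def)
      also have "c' k0 * w k0 j + \<dots> = (\<Sum>k\<in>K - {k0}. c k * u k j)"
        by (simp add: c'_def u_def algebra_simps sum_subtractf sum_distrib_left sum_distrib_right)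
      finally show ?thesis .
    qed
    have "u k i = 0" for k using k0 by (simp add: u_def)
    then have "\<forall>j\<in>insert i I. (\<Sum>k\<in>K. c' k * w k j) = 0" using c rel by simp
    moreover have "\<exists>k\<in>K. c' k \<noteq> 0" using c by (auto simp: c'_def)
    ultimately show ?thesis by blast
  qed
qed

text \<open>
  The powers of \<open>A\<close> applied to a vector satisfy a linear relation, that is, some polynomial in \<open>A\<close>
  annihilates the vector; over the complex numbers it splits, and the last non-zero vector met when
  its linear factors are applied one at a time is an eigenvector.
\<close>

lemma invariant_subspace_eigenvector:
  fixes A :: "('i \<Rightarrow> complex) \<Rightarrow> 'i \<Rightarrow> complex"
  assumes "finite I"
    and supp: "\<And>x i. x \<in> K \<Longrightarrow> i \<notin> I \<Longrightarrow> x i = 0"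
    and add: "\<And>x y. x \<in> K \<Longrightarrow> y \<in> K \<Longrightarrow> (\<lambda>i. x i + y i) \<in> K"
    and scale: "\<And>c x. x \<in> K \<Longrightarrow> (\<lambda>i. c * x i) \<in> K"
    and A: "\<And>x. x \<in> K \<Longrightarrow> A x \<in> K"
    and A_add: "\<And>x y. x \<in> K \<Longrightarrow> y \<in> K \<Longrightarrow> A (\<lambda>i. x i + y i) = (\<lambda>i. A x i + A y i)"
    and A_scale: "\<And>c x. x \<in> K \<Longrightarrow> A (\<lambda>i. c * x i) = (\<lambda>i. c * A x i)"
    and w: "w \<in> K" "w \<noteq> (\<lambda>_. 0)"
  shows "\<exists>\<mu> x. x \<in> K \<and> x \<noteq> (\<lambda>_. 0) \<and> A x = (\<lambda>i. \<mu> * x i)"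
proof -
  have zero: "(\<lambda>_. 0) \<in> K" using scale[OF w(1), of 0] by simp
  have A_zero: "A (\<lambda>_. 0) = (\<lambda>_. 0)" using A_scale[OF w(1), of 0] by simp
  have pw: "(A ^^ k) w \<in> K" for k using w A by (induction k) auto
  have comb: "(\<lambda>i. \<Sum>k\<in>S. c k * (A ^^ k) w i) \<in> K \<and>
      A (\<lambda>i. \<Sum>k\<in>S. c k * (A ^^ k) w i) = (\<lambda>i. \<Sum>k\<in>S. c k * (A ^^ Suc k) w i)"
    if "finite S" for c S
    using that
  proof (induction S)
    case (insert k S)
    then show ?case
      using add[OF scale[OF pw[of k], of "c k"], of "\<lambda>i. \<Sum>k\<in>S. c k * (A ^^ k) w i"]
        A_add[OF scale[OF pw[of k], of "c k"], of "\<lambda>i. \<Sum>k\<in>S. c k * (A ^^ k) w i"]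
        A_scale[OF pw[of k], of "c k"]
      by simp
  qed (simp add: zero A_zero)
  define ev where "ev = (\<lambda>q i. \<Sum>k\<le>degree q. coeff q k * (A ^^ k) w i)"
  have ev: "ev q = (\<lambda>i. \<Sum>k\<le>n. coeff q k * (A ^^ k) w i)" if "degree q \<le> n" for q n
  proof
    fix i
    show "ev q i = (\<Sum>k\<le>n. coeff q k * (A ^^ k) w i)"
      unfolding ev_def using that
      by (intro sum.mono_neutral_left) (auto simp: coeff_eq_0)
  qed
  have evK: "ev q \<in> K" for q unfolding ev_def using comb by blast
  have ev_factor: "ev ([:- \<mu>, 1:] * r) = (\<lambda>i. A (ev r) i - \<mu> * ev r i)" for \<mu> r
  proof
    fix i
    define n where "n = degree r"
    have "degree ([:- \<mu>, 1:] * r) \<le> Suc n"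
      using degree_mult_le[of "[:- \<mu>, 1:]" r] by (simp add: n_def)
    then have "ev ([:- \<mu>, 1:] * r) i = (\<Sum>k\<le>Suc n. coeff ([:- \<mu>, 1:] * r) k * (A ^^ k) w i)"
      using ev by simp
    also have "\<dots> = (\<Sum>k\<le>Suc n. coeff (pCons 0 r) k * (A ^^ k) w i) - \<mu> * (\<Sum>k\<le>Suc n. coeff r k * (A ^^ k) w i)"
      by (simp only: sum_distrib_left flip: sum_subtractf)
        (intro sum.cong refl, simp add: mult_pCons_left algebra_simps)
    also have "(\<Sum>k\<le>Suc n. coeff r k * (A ^^ k) w i) = ev r i"
      using ev[of r "Suc n"] by (simp add: n_def)
    also have "(\<Sum>k\<le>Suc n. coeff (pCons 0 r) k * (A ^^ k) w i) = (\<Sum>k\<le>n. coeff r k * (A ^^ Suc k) w i)"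
      by (subst sum.atMost_Suc_shift) simp
    also have "\<dots> = A (ev r) i"
      using comb[of "{..n}" "coeff r"] by (simp add: ev_def n_def)
    finally show "ev ([:- \<mu>, 1:] * r) i = A (ev r) i - \<mu> * ev r i" .
  qed
  have main: "q \<noteq> 0 \<Longrightarrow> ev q = (\<lambda>_. 0) \<Longrightarrow> ?thesis" for q
  proof (induction "degree q" arbitrary: q rule: less_induct)
    case less
    show ?case
    proof (cases "degree q = 0")
      case True
      then obtain a where a: "q = [:a:]" by (metis degree_eq_zeroE)
      then have "a \<noteq> 0" "(\<lambda>i. a * w i) = (\<lambda>_. 0)" using less by (auto simp: ev_def)
      then have "w = (\<lambda>_. 0)" by (auto simp: fun_eq_iff)
      then show ?thesis using w by simp
    next
      case False
      then have "\<not> constant (poly q)" by (simp add: constant_degree)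
      then obtain \<mu> where "poly q \<mu> = 0" using fundamental_theorem_of_algebra by blast
      then obtain r where r: "q = [:- \<mu>, 1:] * r" by (metis dvdE poly_eq_0_iff_dvd)
      have r0: "r \<noteq> 0" using r less by auto
      have deg: "degree r < degree q" using r0 unfolding r by (subst degree_mult_eq) auto
      have eig: "A (ev r) = (\<lambda>i. \<mu> * ev r i)"
        using less.prems(2) ev_factor[of \<mu> r] unfolding r by (auto simp: fun_eq_iff)
      show ?thesis
      proof (cases "ev r = (\<lambda>_. 0)")
        case True
        then show ?thesis using less.hyps[OF deg r0] by blast
      next
        case False
        then show ?thesis using eig evK[of r] by blast
      qed
    qed
  qed
  obtain c where c: "\<exists>k\<in>{..card I}. c k \<noteq> 0" "\<forall>i\<in>I. (\<Sum>k\<in>{..card I}. c k * (A ^^ k) w i) = 0"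
    using nontrivial_linear_relation[OF \<open>finite I\<close>, of "{..card I}" "\<lambda>k. (A ^^ k) w"] by auto
  define q where "q = Poly (map c [0..<Suc (card I)])"
  have cq: "coeff q k = (if k \<le> card I then c k else 0)" for k
    by (auto simp: q_def nth_default_def simp del: upt_Suc)
  have "q \<noteq> 0" using c(1) cq by (metis atMost_iff coeff_0)
  moreover have "ev q = (\<lambda>_. 0)"
  proof
    fix i
    have "degree q \<le> card I" by (rule degree_le) (simp add: cq)
    then have "ev q i = (\<Sum>k\<le>card I. c k * (A ^^ k) w i)"
      using ev[of q] by (simp add: cq)
    then show "ev q i = 0" using c(2) supp[OF pw] by (cases "i \<in> I") auto
  qed
  ultimately show ?thesis by (rule main)
qed


section \<open>The edge operator\<close>

lemma complexification_iff:
  "z \<in> complexification S \<longleftrightarrow> (\<lambda>e. Re (z e)) \<in> S \<and> (\<lambda>e. Im (z e)) \<in> S"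
  by (force simp: complexification_def complex_eq_iff intro!: ext)

lemma edge_operator_Re: "Re (edge_operator G p w e) = edge_operator G p (\<lambda>e. Re (w e)) e"
  and edge_operator_Im: "Im (edge_operator G p w e) = edge_operator G p (\<lambda>e. Im (w e)) e"
  by (simp_all add: edge_operator_def)

lemma edge_operator_add:
  "edge_operator G p (\<lambda>e. x e + y e) = (\<lambda>e. edge_operator G p x e + edge_operator G p y e)"
  by (simp add: edge_operator_def fun_eq_iff scaleR_add_right sum.distrib)

lemma edge_operator_mult:
  fixes c :: "'k::real_algebra"
  shows "edge_operator G p (\<lambda>e. c * x e) = (\<lambda>e. c * edge_operator G p x e)"
  by (simp add: edge_operator_def fun_eq_iff sum_distrib_left)

lemma edge_operator_zero: "edge_operator G p (\<lambda>_. 0) = (\<lambda>_. 0)"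
  by (simp add: edge_operator_def fun_eq_iff)

lemma rigidity_image_iff:
  assumes "pair_digraph G"
  shows "w \<in> rigidity_image G p \<longleftrightarrow> (\<exists>x. w = (\<lambda>e. if e \<in> parcs G then stretch p x e else 0))"
proof -
  interpret pair_digraph G by fact
  have R: "(\<Sum>v\<in>pverts G. rigidity_matrix p e v \<bullet> x v) = stretch p x e" if "e \<in> parcs G" for e x
    using sum_rigidity_matrix[OF pair_finite_verts, of "fst e" "snd e" p x] that
      pair_no_loops[of e] arc_fst_in_verts[of e] arc_snd_in_verts[of e] by simp
  have eq: "(\<lambda>e. if e \<in> parcs G then \<Sum>v\<in>pverts G. rigidity_matrix p e v \<bullet> x v else 0) =
      (\<lambda>e. if e \<in> parcs G then stretch p x e else 0)" for x
    by (auto simp: R)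
  have restrict: "(\<lambda>e. if e \<in> parcs G then stretch p x e else 0) =
      (\<lambda>e. if e \<in> parcs G then stretch p (restrict_config (pverts G) x) e else 0)" for x
    by (auto simp: fun_eq_iff stretch_def restrict_config_def in_arcsD1 in_arcsD2)
  show ?thesis
    unfolding rigidity_image_def image_iff eq
  proof (intro iffI; elim exE bexE)
    fix x assume "w = (\<lambda>e. if e \<in> parcs G then stretch p x e else 0)"
    then show "\<exists>x\<in>vectors_on (pverts G). w = (\<lambda>e. if e \<in> parcs G then stretch p x e else 0)"
      by (subst (asm) restrict) (rule bexI[OF _ restrict_config_in_vectors_on])
  qed (rule exI)
qed

text \<open>The factorisation \<open>Z = 2 R \<cdot> tail_load\<close>, where \<open>tail_load\<close> is the transpose of the directed rigidity matrix.\<close>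

definition tail_load ::
    "'v pair_pre_digraph \<Rightarrow> ('v \<Rightarrow> real^'d) \<Rightarrow> ('v \<times> 'v \<Rightarrow> real) \<Rightarrow> 'v \<Rightarrow> real^'d" where
  "tail_load G p w v = (\<Sum>e\<in>parcs G. if fst e = v then w e *\<^sub>R (p v - p (snd e)) else 0)"

lemma edge_operator_stretch:
  assumes "pair_digraph G"
  shows "edge_operator G p w = (\<lambda>e. if e \<in> parcs G then 2 * stretch p (tail_load G p w) e else 0)"
proof
  interpret pair_digraph G by fact
  fix e
  show "edge_operator G p w e = (if e \<in> parcs G then 2 * stretch p (tail_load G p w) e else 0)"
  proof (cases "e \<in> parcs G")
    case True
    have D: "(w f :: real) *\<^sub>R directed_rigidity_matrix p f v = (if fst f = v then w f *\<^sub>R (p v - p (snd f)) else 0)"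
      for f v by (cases f) (auto simp: directed_rigidity_matrix_def rigidity_matrix_def)
    have "(\<Sum>f\<in>parcs G. edge_matrix G p e f *\<^sub>R w f) =
        2 * (\<Sum>v\<in>pverts G. rigidity_matrix p e v \<bullet> (\<Sum>f\<in>parcs G. w f *\<^sub>R directed_rigidity_matrix p f v))"
      unfolding edge_matrix_def
      by (simp add: inner_sum_right sum_distrib_left sum_distrib_right ac_simps)
        (rule sum.swap)
    also have "\<dots> = 2 * stretch p (tail_load G p w) e"
      unfolding D tail_load_def[symmetric]
      using sum_rigidity_matrix[OF pair_finite_verts, of "fst e" "snd e" p "tail_load G p w"] True
        pair_no_loops[of e] arc_fst_in_verts[of e] arc_snd_in_verts[of e] by simp
    finally show ?thesis using True by (simp add: edge_operator_def)
  qed (simp add: edge_operator_def)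
qed

lemma stretch_add: "stretch p (\<lambda>v. x v + y v) e = stretch p x e + stretch p y e"
  by (cases e) (simp add: stretch_def algebra_simps)

lemma stretch_scaleR: "stretch p (\<lambda>v. c *\<^sub>R x v) e = c * stretch p x e"
  by (cases e) (simp add: stretch_def algebra_simps)

lemma rigidity_image_add:
  assumes "pair_digraph G" "x \<in> rigidity_image G p" "y \<in> rigidity_image G p"
  shows "(\<lambda>e. x e + y e) \<in> rigidity_image G p"
proof -
  obtain a b where "x = (\<lambda>e. if e \<in> parcs G then stretch p a e else 0)"
    "y = (\<lambda>e. if e \<in> parcs G then stretch p b e else 0)"
    using assms by (auto simp: rigidity_image_iff)
  then show ?thesis unfolding rigidity_image_iff[OF assms(1)]
    by (intro exI[of _ "\<lambda>v. a v + b v"]) (auto simp: stretch_add)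
qed

lemma rigidity_image_mult:
  assumes "pair_digraph G" "x \<in> rigidity_image G p"
  shows "(\<lambda>e. c * x e) \<in> rigidity_image G p"
proof -
  obtain a where "x = (\<lambda>e. if e \<in> parcs G then stretch p a e else 0)"
    using assms by (auto simp: rigidity_image_iff)
  then show ?thesis unfolding rigidity_image_iff[OF assms(1)]
    by (intro exI[of _ "\<lambda>v. c *\<^sub>R a v"]) (auto simp: stretch_scaleR)
qed

lemma rigidity_image_zero: "pair_digraph G \<Longrightarrow> (\<lambda>_. 0) \<in> rigidity_image G p"
  unfolding rigidity_image_iff by (intro exI[of _ "\<lambda>_. 0"]) (auto simp: stretch_def)

lemma rigidity_image_diff:
  assumes "pair_digraph G" "x \<in> rigidity_image G p" "y \<in> rigidity_image G p"
  shows "(\<lambda>e. x e - y e) \<in> rigidity_image G p"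
  using rigidity_image_add[OF assms(1,2) rigidity_image_mult[OF assms(1,3), of "-1"]] by simp

lemma rigidity_image_outside: "w \<in> rigidity_image G p \<Longrightarrow> e \<notin> parcs G \<Longrightarrow> w e = 0"
  by (auto simp: rigidity_image_def)

lemma edge_eigenvalue_iff:
  "\<mu> \<in> eigenvalues_on (rigidity_image G p) (edge_operator G p) \<longleftrightarrow>
     (\<exists>a\<in>rigidity_image G p. \<exists>b\<in>rigidity_image G p. (a \<noteq> (\<lambda>_. 0) \<or> b \<noteq> (\<lambda>_. 0)) \<and>
        (\<forall>e. edge_operator G p a e = Re \<mu> * a e - Im \<mu> * b e) \<and>
        (\<forall>e. edge_operator G p b e = Re \<mu> * b e + Im \<mu> * a e))"
  (is "?L \<longleftrightarrow> ?R")
proof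
  assume ?L
  then obtain w where w: "w \<in> complexification (rigidity_image G p)" "w \<noteq> (\<lambda>_. 0)"
    "edge_operator G p w = (\<lambda>e. \<mu> * w e)" by (auto simp: eigenvalues_on_def)
  define a b where "a = (\<lambda>e. Re (w e))" and "b = (\<lambda>e. Im (w e))"
  have "a \<in> rigidity_image G p" "b \<in> rigidity_image G p"
    using w(1) by (auto simp: complexification_iff a_def b_def)
  moreover have "a \<noteq> (\<lambda>_. 0) \<or> b \<noteq> (\<lambda>_. 0)"
    using w(2) by (auto simp: fun_eq_iff complex_eq_iff a_def b_def)
  moreover have "edge_operator G p a e = Re \<mu> * a e - Im \<mu> * b e" for e
    unfolding a_def edge_operator_Re[symmetric] w(3) by (simp add: b_def)
  moreover have "edge_operator G p b e = Re \<mu> * b e + Im \<mu> * a e" for e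
    unfolding b_def edge_operator_Im[symmetric] w(3) by (simp add: a_def)
  ultimately show ?R by blast
next
  assume ?R
  then obtain a b where ab: "a \<in> rigidity_image G p" "b \<in> rigidity_image G p"
    "a \<noteq> (\<lambda>_. 0) \<or> b \<noteq> (\<lambda>_. 0)"
    "\<And>e. edge_operator G p a e = Re \<mu> * a e - Im \<mu> * b e"
    "\<And>e. edge_operator G p b e = Re \<mu> * b e + Im \<mu> * a e" by blast
  have "edge_operator G p (\<lambda>e. Complex (a e) (b e)) = (\<lambda>e. \<mu> * Complex (a e) (b e))"
    by (rule ext) (simp add: complex_eq_iff edge_operator_Re edge_operator_Im ab)
  moreover have "(\<lambda>e. Complex (a e) (b e)) \<in> complexification (rigidity_image G p)"
    using ab(1,2) by (simp add: complexification_iff)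
  moreover have "(\<lambda>e. Complex (a e) (b e)) \<noteq> (\<lambda>_. 0)"
    using ab(3) by (metis complex.sel zero_complex.sel)
  ultimately show ?L unfolding eigenvalues_on_def by blast
qed


section \<open>Positive spectrum and strong admissibility\<close>

text \<open>
  The property that root extensions inherit configuration by configuration, and that a single generic
  configuration converts into strong admissibility.
\<close>

definition positive_spectrum :: "'v pair_pre_digraph \<Rightarrow> ('v \<Rightarrow> real^'d) \<Rightarrow> bool" where
  "positive_spectrum G p \<longleftrightarrow>
     (\<forall>\<mu> \<in> eigenvalues_on (rigidity_image G p) (edge_operator G p). Re \<mu> > 0)"

text \<open>
  Uniqueness for the Sylvester equation \<open>Z W + W Z\<^sup>T = 0\<close>. The solutions with rows and columns in the
  complexified image form a space invariant under \<open>W \<mapsto> Z W\<close>; for an eigenvector \<open>W\<close>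
  with eigenvalue \<open>\<lambda>\<close>, a non-zero column of \<open>W\<close> has eigenvalue \<open>\<lambda>\<close> under \<open>Z\<close> and a non-zero row
  has eigenvalue \<open>-\<lambda>\<close>.
\<close>

lemma positive_spectrum_sylvester:
  fixes p :: "'v \<Rightarrow> real^'d" and W :: "'v \<times> 'v \<Rightarrow> 'v \<times> 'v \<Rightarrow> real"
  assumes G: "pair_digraph G" and pos: "positive_spectrum G p"
    and cols: "\<And>f. (\<lambda>e. W e f) \<in> rigidity_image G p"
    and rows: "\<And>e. W e \<in> rigidity_image G p"
    and sylvester: "\<And>e f. e \<in> parcs G \<Longrightarrow> f \<in> parcs G \<Longrightarrow>
      edge_operator G p (\<lambda>e. W e f) e + edge_operator G p (W e) f = 0"
  shows "W e f = 0"
proof (rule ccontr)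
  assume nz: "W e f \<noteq> 0"
  interpret pair_digraph G by fact
  define U where "U = complexification (rigidity_image G p)"
  define L where "L = (edge_operator G p :: ('v \<times> 'v \<Rightarrow> complex) \<Rightarrow> 'v \<times> 'v \<Rightarrow> complex)"
  have U_add: "(\<lambda>e. x e + y e) \<in> U" if "x \<in> U" "y \<in> U" for x y
    using that unfolding U_def complexification_iff by (auto intro!: rigidity_image_add[OF G])
  have U_mult: "(\<lambda>e. c * x e) \<in> U" if "x \<in> U" for x c
    using that unfolding U_def complexification_iff
    by (auto intro!: rigidity_image_add[OF G] rigidity_image_diff[OF G] rigidity_image_mult[OF G])
  have U_sum: "(\<lambda>e. \<Sum>s\<in>S. c s * x s e) \<in> U" if "finite S" "\<And>s. s \<in> S \<Longrightarrow> x s \<in> U" for S c and x :: "'v \<times> 'v \<Rightarrow> _"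
    using that
  proof (induction S)
    case empty
    then show ?case by (simp add: U_def complexification_iff rigidity_image_zero[OF G])
  next
    case (insert s S)
    then show ?case using U_add[OF U_mult[of "x s" "c s"]] by simp
  qed
  have U_L: "L x \<in> U" for x
    unfolding U_def complexification_iff L_def edge_operator_Re edge_operator_Im
    by (simp add: edge_operator_in_rigidity_image)
  have U_out: "x e = 0" if "x \<in> U" "e \<notin> parcs G" for x e
    using that rigidity_image_outside[of _ G p e]
    unfolding U_def complexification_iff by (auto simp: complex_eq_iff)
  have L_sum: "L x e = (\<Sum>e'\<in>parcs G. of_real (edge_matrix G p e e') * x e')" if "e \<in> parcs G" for x e
    using that by (simp add: L_def edge_operator_def scaleR_conv_of_real)
  have L_out: "L x e = 0" if "e \<notin> parcs G" for x e
    using that by (simp add: L_def edge_operator_def)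
  define K where "K = {X :: ('v \<times> 'v) \<times> ('v \<times> 'v) \<Rightarrow> complex.
    (\<forall>f. (\<lambda>e. X (e, f)) \<in> U) \<and> (\<forall>e. (\<lambda>f. X (e, f)) \<in> U) \<and>
    (\<forall>e f. L (\<lambda>e. X (e, f)) e + L (\<lambda>f. X (e, f)) f = 0)}"
  have K_col: "(\<lambda>e. X (e, f)) \<in> U" and K_row: "(\<lambda>f. X (e, f)) \<in> U"
    and K_eq: "L (\<lambda>e. X (e, f)) e + L (\<lambda>f. X (e, f)) f = 0" if "X \<in> K" for X e f
    using that unfolding K_def by blast+
  have K_I: "X \<in> K" if "\<And>f. (\<lambda>e. X (e, f)) \<in> U" "\<And>e. (\<lambda>f. X (e, f)) \<in> U"
      "\<And>e f. L (\<lambda>e. X (e, f)) e + L (\<lambda>f. X (e, f)) f = 0" for X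
    using that unfolding K_def by blast
  define A where "A = (\<lambda>(X :: ('v \<times> 'v) \<times> ('v \<times> 'v) \<Rightarrow> complex) (e, f). L (\<lambda>e. X (e, f)) e)"
  have "\<exists>\<mu> X. X \<in> K \<and> X \<noteq> (\<lambda>_. 0) \<and> A X = (\<lambda>i. \<mu> * X i)"
  proof (rule invariant_subspace_eigenvector)
    show "finite (parcs G \<times> parcs G)" using pair_finite_arcs by simp
    show "X i = 0" if X: "X \<in> K" and i: "i \<notin> parcs G \<times> parcs G" for X i
    proof (cases "fst i \<in> parcs G")
      case True
      then have "snd i \<notin> parcs G" using i by (cases i) auto
      then show ?thesis using U_out[OF K_row[OF X], of "snd i" "fst i"] by simp
    next
      case False
      then show ?thesis using U_out[OF K_col[OF X], of "fst i" "snd i"] by simp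
    qed
    show "(\<lambda>i. X i + Y i) \<in> K" if "X \<in> K" "Y \<in> K" for X Y
    proof -
      have "L (\<lambda>e. X (e, f) + Y (e, f)) e + L (\<lambda>f. X (e, f) + Y (e, f)) f =
        (L (\<lambda>e. X (e, f)) e + L (\<lambda>f. X (e, f)) f) + (L (\<lambda>e. Y (e, f)) e + L (\<lambda>f. Y (e, f)) f)" for e f
        unfolding L_def edge_operator_add by simp
      then show ?thesis using that by (intro K_I) (auto intro: U_add K_col K_row simp: K_eq)
    qed
    show "(\<lambda>i. c * X i) \<in> K" if "X \<in> K" for X c
    proof -
      have "L (\<lambda>e. c * X (e, f)) e + L (\<lambda>f. c * X (e, f)) f =
        c * (L (\<lambda>e. X (e, f)) e + L (\<lambda>f. X (e, f)) f)" for e f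
        unfolding L_def edge_operator_mult by (simp add: algebra_simps)
      then show ?thesis using that by (intro K_I) (auto intro: U_mult K_col K_row simp: K_eq)
    qed
    show "A X \<in> K" if X: "X \<in> K" for X
    proof -
      have "(\<lambda>e. A X (e, f)) \<in> U" for f by (simp add: A_def U_L)
      moreover have "(\<lambda>f. A X (e, f)) \<in> U" for e
      proof (cases "e \<in> parcs G")
        case True
        then show ?thesis
          using U_sum[OF pair_finite_arcs K_row[OF X], of "\<lambda>e'. of_real (edge_matrix G p e e')" "\<lambda>e'. e'"]
          by (simp add: A_def L_sum)
      next
        case False
        then show ?thesis using U_sum[of "{}"] by (simp add: A_def L_out)
      qed
      moreover have "L (\<lambda>e. A X (e, f)) e + L (\<lambda>f. A X (e, f)) f = 0" for e f
      proof (cases "e \<in> parcs G \<and> f \<in> parcs G")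
        case True
        \<comment> \<open>\<open>W \<mapsto> Z W\<close> commutes with \<open>W \<mapsto> W Z\<^sup>T\<close>.\<close>
        have "L (\<lambda>f. A X (e, f)) f = L (\<lambda>e. L (\<lambda>f. X (e, f)) f) e"
          using True
          by (simp add: A_def L_sum sum_distrib_left mult_ac) (rule sum.swap)
        then have "L (\<lambda>e. A X (e, f)) e + L (\<lambda>f. A X (e, f)) f =
            L (\<lambda>e. L (\<lambda>e. X (e, f)) e + L (\<lambda>f. X (e, f)) f) e"
          unfolding A_def L_def edge_operator_add by simp
        also have "(\<lambda>e. L (\<lambda>e. X (e, f)) e + L (\<lambda>f. X (e, f)) f) = (\<lambda>_. 0)"
          by (simp add: K_eq[OF X])
        finally show ?thesis by (simp add: L_def edge_operator_zero)
      next
        case False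
        have f0: "(\<lambda>e. X (e, f)) = (\<lambda>_. 0)" if "f \<notin> parcs G"
          using U_out[OF K_row[OF X] that] by auto
        show ?thesis
        proof (cases "e \<in> parcs G")
          case True
          then have "f \<notin> parcs G" using False by simp
          then show ?thesis using f0 by (simp add: A_def L_out) (simp add: L_def edge_operator_zero)
        next
          case False
          then have "(\<lambda>f. A X (e, f)) = (\<lambda>_. 0)" by (simp add: A_def L_out)
          then show ?thesis using False by (simp add: L_out) (simp add: L_def edge_operator_zero)
        qed
      qed
      ultimately show ?thesis by (rule K_I)
    qed
    show "A (\<lambda>i. X i + Y i) = (\<lambda>i. A X i + A Y i)" for X Y
      unfolding A_def L_def edge_operator_add by (auto simp: fun_eq_iff)
    show "A (\<lambda>i. c * X i) = (\<lambda>i. c * A X i)" for X c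
      unfolding A_def L_def edge_operator_mult by (auto simp: fun_eq_iff)
    define X0 where "X0 = (\<lambda>(e, f). complex_of_real (W e f))"
    have real_L: "L (\<lambda>e. of_real (x e)) e = of_real (edge_operator G p x e)" for x e
      by (simp add: complex_eq_iff L_def edge_operator_Re edge_operator_Im edge_operator_zero)
    have "L (\<lambda>e. X0 (e, f)) e + L (\<lambda>f. X0 (e, f)) f = 0" for e f
    proof (cases "e \<in> parcs G \<and> f \<in> parcs G")
      case True
      then show ?thesis using sylvester[of e f] unfolding X0_def
        by (simp add: real_L flip: of_real_add)
    next
      case False
      have W0: "W e f = 0" if "e \<notin> parcs G \<or> f \<notin> parcs G" for e f
        using that rigidity_image_outside[OF cols, of e f] rigidity_image_outside[OF rows, of f e] by auto
      show ?thesis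
      proof (cases "e \<in> parcs G")
        case True
        then have "f \<notin> parcs G" using False by simp
        then show ?thesis
          by (simp add: X0_def W0 L_out) (simp add: L_def edge_operator_zero)
      next
        case False
        then show ?thesis
          by (simp add: X0_def W0 L_out) (simp add: L_def edge_operator_zero)
      qed
    qed
    moreover have "(\<lambda>e. complex_of_real (x e)) \<in> U" if "x \<in> rigidity_image G p" for x
      using that by (simp add: U_def complexification_iff rigidity_image_zero[OF G])
    ultimately show "X0 \<in> K" using rows cols by (intro K_I) (simp_all add: X0_def)
    show "X0 \<noteq> (\<lambda>_. 0)"
      using nz by (auto simp: X0_def dest!: fun_cong[where x = "(e, f)"])
  qed
  then obtain \<mu> X where X: "X \<in> K" "X \<noteq> (\<lambda>_. 0)" "A X = (\<lambda>i. \<mu> * X i)" by blast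
  then obtain e0 f0 where ef: "X (e0, f0) \<noteq> 0" by (auto simp: fun_eq_iff)
  have A: "L (\<lambda>e. X (e, f)) e = \<mu> * X (e, f)" for e f
    using fun_cong[OF X(3), of "(e, f)"] by (simp add: A_def)
  have B: "L (\<lambda>f. X (e, f)) f = - \<mu> * X (e, f)" for e f
    using K_eq[where e = e and f = f, OF X(1)] A[where e = e and f = f] by (simp add: add_eq_0_iff)
  have "\<mu> \<in> eigenvalues_on (rigidity_image G p) (edge_operator G p)"
    unfolding eigenvalues_on_def mem_Collect_eq
  proof (intro bexI[of _ "\<lambda>e. X (e, f0)"] conjI)
    show "(\<lambda>e. X (e, f0)) \<noteq> (\<lambda>_. 0)" using ef by metis
    show "edge_operator G p (\<lambda>e. X (e, f0)) = (\<lambda>e. \<mu> * X (e, f0))"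
      using A by (intro ext) (simp add: L_def)
  qed (use K_col[OF X(1), of f0] in \<open>simp add: U_def\<close>)
  moreover have "- \<mu> \<in> eigenvalues_on (rigidity_image G p) (edge_operator G p)"
    unfolding eigenvalues_on_def mem_Collect_eq
  proof (intro bexI[of _ "\<lambda>f. X (e0, f)"] conjI)
    show "(\<lambda>f. X (e0, f)) \<noteq> (\<lambda>_. 0)" using ef by metis
    show "edge_operator G p (\<lambda>f. X (e0, f)) = (\<lambda>f. - \<mu> * X (e0, f))"
      using B by (intro ext) (simp add: L_def)
  qed (use K_row[OF X(1), of e0] in \<open>simp add: U_def\<close>)
  ultimately have "Re \<mu> > 0" "Re (- \<mu>) > 0"
    using pos unfolding positive_spectrum_def by blast+
  then show False by simp
qed

lemma rat_poly_fun_edge_matrix: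
  assumes "pair_digraph G" "e \<in> parcs G" "f \<in> parcs G"
  shows "rat_poly_fun (pverts G) (\<lambda>p :: 'v \<Rightarrow> real^'d. edge_matrix G p e f)"
proof -
  interpret pair_digraph G by fact
  have R: "rat_poly_fun (pverts G) (\<lambda>p :: 'v \<Rightarrow> real^'d. rigidity_matrix p e v $ k)" if "e \<in> parcs G" for e v k
    using rat_poly_fun_rigidity_matrix[of "fst e" "pverts G" "snd e"] that
      arc_fst_in_verts[of e] arc_snd_in_verts[of e] by simp
  have "rat_poly_fun (pverts G) (\<lambda>p :: 'v \<Rightarrow> real^'d. directed_rigidity_matrix p f v $ k)" for v k
    using R[OF assms(3)]
    by (cases f; cases "v = fst f") (auto simp: directed_rigidity_matrix_def intro!: rat_poly_fun.const)
  then show ?thesis unfolding edge_matrix_def inner_vec_def inner_real_def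
    using R[OF assms(2)] by (intro rat_poly_fun_intros) auto
qed

text \<open>
  For \<open>w = a + \<i> b\<close> with eigenvalue on the imaginary axis, \<open>a a\<^sup>T + b b\<^sup>T\<close> is a non-zero solution of the
  Sylvester equation in the tensor square of the image. Unlike the position of the eigenvalues, the
  existence of such a solution is a polynomial condition on the configuration, so excluding it at one
  generic configuration excludes it at almost all.
\<close>

lemma generic_positive_spectrum_imp_strongly_admissible:
  fixes G :: "'v pair_pre_digraph"
  assumes G: "pair_digraph G" and rigid: "generically_rigid TYPE('d::finite) G"
  shows "for_generic (pverts G)
    (\<lambda>p :: 'v \<Rightarrow> real^'d. positive_spectrum G p \<longrightarrow> strongly_admissible TYPE('d) G)"
proof -
  interpret pair_digraph G by fact
  define V where "V = pverts G"
  define E where "E = parcs G"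
  define S where "S = V \<times> (UNIV :: 'd set)"
  have V: "finite V" and E: "finite E" and S: "finite S"
    using pair_finite_verts pair_finite_arcs by (auto simp: V_def E_def S_def)
  define R where "R = (\<lambda>(p :: 'v \<Rightarrow> real^'d) e (s :: 'v \<times> 'd). rigidity_matrix p e (fst s) $ snd s)"
  define Q where "Q = (\<lambda>(p :: 'v \<Rightarrow> real^'d) e s. \<Sum>e'\<in>E. edge_matrix G p e e' * R p e' s)"
  have Rsum: "(\<Sum>s\<in>S. R p e s * (x (fst s) $ snd s)) = (\<Sum>v\<in>V. rigidity_matrix p e v \<bullet> x v)" for p e x
    by (simp add: R_def S_def sum.cartesian_product' inner_vec_def)
  have image_coords: "\<exists>x. \<forall>e\<in>E. a e = (\<Sum>s\<in>S. R p e s * x s)" if a: "a \<in> rigidity_image G p" for a p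
  proof -
    obtain x where "a = (\<lambda>e. if e \<in> E then \<Sum>v\<in>V. rigidity_matrix p e v \<bullet> x v else 0)"
      using a unfolding rigidity_image_def E_def V_def by blast
    then show ?thesis by (intro exI[of _ "\<lambda>s. x (fst s) $ snd s"]) (simp add: Rsum)
  qed
  have in_image: "(\<lambda>e. if e \<in> E then \<Sum>s\<in>S. R p e s * x s else 0) \<in> rigidity_image G p" for p x
  proof -
    define y where "y = (\<lambda>v. if v \<in> V then \<chi> k. x (v, k) else 0)"
    have "(\<Sum>s\<in>S. R p e s * x s) = (\<Sum>s\<in>S. R p e s * (y (fst s) $ snd s))" for e
      by (rule sum.cong) (auto simp: S_def y_def)
    moreover have "y \<in> vectors_on V" by (simp add: y_def vectors_on_def)
    ultimately show ?thesis
      unfolding rigidity_image_def E_def[symmetric] V_def[symmetric]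
      by (intro image_eqI[of _ _ y]) (auto simp: Rsum fun_eq_iff)
  qed
  have op: "edge_operator G p a e = (\<Sum>s\<in>S. Q p e s * x s)"
    if "e \<in> E" "\<forall>e\<in>E. a e = (\<Sum>s\<in>S. R p e s * x s)" for p a e x
  proof -
    have "edge_operator G p a e = (\<Sum>e'\<in>E. edge_matrix G p e e' * (\<Sum>s\<in>S. R p e' s * x s))"
      using that by (simp add: edge_operator_def E_def)
    also have "\<dots> = (\<Sum>s\<in>S. Q p e s * x s)"
      unfolding Q_def by (simp add: sum_distrib_left sum_distrib_right mult_ac) (rule sum.swap)
    finally show ?thesis .
  qed
  have prod: "(\<Sum>st\<in>S \<times> S. (u (fst st) * v (snd st)) * (x (fst st) * y (snd st))) =
      (\<Sum>s\<in>S. u s * x s) * (\<Sum>t\<in>S. v t * y t)" for u v x y :: "'v \<times> 'd \<Rightarrow> real"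
    by (simp add: sum.cartesian_product' sum_product mult_ac)
  define w where "w = (\<lambda>ef p st. Q p (fst ef) (fst st) * R p (snd ef) (snd st)
    + R p (fst ef) (fst st) * Q p (snd ef) (snd st))"
  define g where "g = (\<lambda>e p st. R p e (fst st) * R p e (snd st))"
  have Rpoly: "rat_poly_fun V (\<lambda>p. R p e s)" if "e \<in> E" for e s
    using rat_poly_fun_rigidity_matrix[of "fst e" V "snd e"] that
      arc_fst_in_verts[of e] arc_snd_in_verts[of e] by (simp add: R_def V_def E_def)
  have Qpoly: "rat_poly_fun V (\<lambda>p. Q p e s)" if "e \<in> E" for e s
  proof -
    have "rat_poly_fun V (\<lambda>p :: 'v \<Rightarrow> real^'d. edge_matrix G p e f)" if "f \<in> E" for f
      using rat_poly_fun_edge_matrix[OF G] that \<open>e \<in> E\<close> by (simp add: E_def V_def)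
    then show ?thesis unfolding Q_def using Rpoly by (intro rat_poly_fun_intros) auto
  qed
  have wpoly: "rat_poly_fun V (\<lambda>p. w ef p st)" if "ef \<in> E \<times> E" for ef st
    unfolding w_def using that by (intro rat_poly_fun_intros Rpoly Qpoly) auto
  have gpoly: "rat_poly_fun V (\<lambda>p. g e p st)" if "e \<in> E" for e st
    unfolding g_def using that by (intro rat_poly_fun_intros Rpoly)
  define spanned where "spanned = (\<lambda>e p. \<exists>c. \<forall>st\<in>S \<times> S. g e p st = (\<Sum>ef\<in>E \<times> E. c ef * w ef p st))"
  show ?thesis
  proof (cases "\<forall>e\<in>E. for_generic V (spanned e)")
    case True
    then have "for_generic V (\<lambda>p. \<forall>e\<in>E. spanned e p)" using E by (intro for_generic_ball) auto
    then have "for_generic V (\<lambda>p :: 'v \<Rightarrow> real^'d.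
        \<forall>\<mu> \<in> eigenvalues_on (rigidity_image G p) (edge_operator G p). Re \<mu> \<noteq> 0)"
    proof (rule for_generic_mono, intro ballI notI)
      fix p :: "'v \<Rightarrow> real^'d" and \<mu>
      assume sp: "\<forall>e\<in>E. spanned e p"
        and "\<mu> \<in> eigenvalues_on (rigidity_image G p) (edge_operator G p)" and Re: "Re \<mu> = 0"
      then obtain a b where ab: "a \<in> rigidity_image G p" "b \<in> rigidity_image G p"
          "a \<noteq> (\<lambda>_. 0) \<or> b \<noteq> (\<lambda>_. 0)"
          "\<And>e. edge_operator G p a e = - Im \<mu> * b e" "\<And>e. edge_operator G p b e = Im \<mu> * a e"
        by (auto simp: edge_eigenvalue_iff)
      obtain x where x: "\<forall>e\<in>E. a e = (\<Sum>s\<in>S. R p e s * x s)" using image_coords ab by blast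
      obtain y where y: "\<forall>e\<in>E. b e = (\<Sum>s\<in>S. R p e s * y s)" using image_coords ab by blast
      define \<xi> where "\<xi> = (\<lambda>st. x (fst st) * x (snd st) + y (fst st) * y (snd st))"
      have w0: "(\<Sum>st\<in>S \<times> S. w ef p st * \<xi> st) = 0" if EE: "ef \<in> E \<times> E" for ef
      proof -
        obtain e f where ef: "ef = (e, f)" "e \<in> E" "f \<in> E" using EE by auto
        have "(\<Sum>st\<in>S \<times> S. w ef p st * \<xi> st) =
            edge_operator G p a e * a f + a e * edge_operator G p a f
            + edge_operator G p b e * b f + b e * edge_operator G p b f"
          using ef op[OF _ x] op[OF _ y] x y
          by (simp add: w_def \<xi>_def distrib_left distrib_right sum.distrib prod)
        then show ?thesis by (simp add: ab)
      qed
      have "a e = 0 \<and> b e = 0" for e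
      proof (cases "e \<in> E")
        case True
        then obtain c where c: "\<forall>st\<in>S \<times> S. g e p st = (\<Sum>ef\<in>E \<times> E. c ef * w ef p st)"
          using sp unfolding spanned_def by blast
        have "a e * a e + b e * b e = (\<Sum>st\<in>S \<times> S. g e p st * \<xi> st)"
          using True x y by (simp add: g_def \<xi>_def distrib_left sum.distrib prod)
        also have "\<dots> = (\<Sum>st\<in>S \<times> S. (\<Sum>ef\<in>E \<times> E. c ef * w ef p st) * \<xi> st)"
          using c by (intro sum.cong) auto
        also have "\<dots> = (\<Sum>ef\<in>E \<times> E. c ef * (\<Sum>st\<in>S \<times> S. w ef p st * \<xi> st))"
          by (subst sum_distrib_left, subst sum.swap) (simp add: sum_distrib_right mult.assoc)
        also have "\<dots> = 0" using w0 by simp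
        finally show ?thesis by (simp add: sum_squares_eq_zero_iff)
      next
        case False
        then show ?thesis using ab rigidity_image_outside[of _ G p e] by (auto simp: E_def)
      qed
      then show False using ab(3) by auto
    qed
    then have "strongly_admissible TYPE('d) G"
      using rigid by (simp add: strongly_admissible_def V_def)
    then show ?thesis by (simp add: for_generic_True)
  next
    case False
    then obtain e where e: "e \<in> E" "\<not> for_generic V (spanned e)" by blast
    show ?thesis
    proof (rule generic_span_or_kernel[of "E \<times> E" "S \<times> S" V w "g e"])
      assume "for_generic V (\<lambda>p. \<exists>c. \<forall>st\<in>S \<times> S. g e p st = (\<Sum>ef\<in>E \<times> E. c ef * w ef p st))"
      then show ?thesis using e by (simp add: spanned_def)
    next
      fix f :: "('v \<Rightarrow> real^'d) \<Rightarrow> real" and X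
      assume f: "rat_poly_fun V f" "nonzero_on V f"
        and Xw: "\<And>p ef. p \<in> vectors_on V \<Longrightarrow> f p \<noteq> 0 \<Longrightarrow> ef \<in> E \<times> E \<Longrightarrow>
          (\<Sum>st\<in>S \<times> S. X p st * w ef p st) = 0"
        and Xg: "\<And>p. p \<in> vectors_on V \<Longrightarrow> f p \<noteq> 0 \<Longrightarrow> (\<Sum>st\<in>S \<times> S. X p st * g e p st) \<noteq> 0"
      have "for_generic V (\<lambda>p :: 'v \<Rightarrow> real^'d. \<not> positive_spectrum G p)"
      proof (rule for_genericI[OF f], rule notI)
        fix p :: "'v \<Rightarrow> real^'d" assume p: "p \<in> vectors_on V" "f p \<noteq> 0" and pos: "positive_spectrum G p"
        define W where "W = (\<lambda>e f. if e \<in> E \<and> f \<in> E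
          then \<Sum>s\<in>S. \<Sum>t\<in>S. X p (s, t) * (R p e s * R p f t) else 0)"
        have col: "(\<lambda>e. W e f) = (\<lambda>e. if e \<in> E then \<Sum>s\<in>S. R p e s * (if f \<in> E then \<Sum>t\<in>S. X p (s, t) * R p f t else 0) else 0)" for f
          by (auto simp: W_def fun_eq_iff sum_distrib_left mult_ac)
        have row: "W e = (\<lambda>f. if f \<in> E then \<Sum>t\<in>S. R p f t * (if e \<in> E then \<Sum>s\<in>S. X p (s, t) * R p e s else 0) else 0)" for e
          by (auto simp: W_def fun_eq_iff sum_distrib_left mult_ac intro: sum.swap)
        have "W e e = 0"
        proof (rule positive_spectrum_sylvester[OF G pos, where W = W])
          show "\<And>f. (\<lambda>e. W e f) \<in> rigidity_image G p" unfolding col by (rule in_image)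
          show "\<And>e. W e \<in> rigidity_image G p" unfolding row by (rule in_image)
          show "edge_operator G p (\<lambda>e. W e f) e + edge_operator G p (W e) f = 0"
            if "e \<in> parcs G" "f \<in> parcs G" for e f
          proof -
            have ef: "e \<in> E" "f \<in> E" using that by (auto simp: E_def)
            have "edge_operator G p (\<lambda>e. W e f) e = (\<Sum>s\<in>S. Q p e s * (\<Sum>t\<in>S. X p (s, t) * R p f t))"
              using ef by (intro op) (auto simp: fun_cong[OF col])
            also have "\<dots> = (\<Sum>s\<in>S. \<Sum>t\<in>S. X p (s, t) * (Q p e s * R p f t))"
              by (simp add: sum_distrib_left mult_ac)
            finally have 1: "edge_operator G p (\<lambda>e. W e f) e = (\<Sum>s\<in>S. \<Sum>t\<in>S. X p (s, t) * (Q p e s * R p f t))" .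
            have "edge_operator G p (W e) f = (\<Sum>t\<in>S. Q p f t * (\<Sum>s\<in>S. X p (s, t) * R p e s))"
              using ef by (intro op) (auto simp: row)
            also have "\<dots> = (\<Sum>t\<in>S. \<Sum>s\<in>S. X p (s, t) * (R p e s * Q p f t))"
              by (simp add: sum_distrib_left mult_ac)
            also have "\<dots> = (\<Sum>s\<in>S. \<Sum>t\<in>S. X p (s, t) * (R p e s * Q p f t))"
              by (rule sum.swap)
            finally have 2: "edge_operator G p (W e) f = (\<Sum>s\<in>S. \<Sum>t\<in>S. X p (s, t) * (R p e s * Q p f t))" .
            show ?thesis using Xw[OF p, of "(e, f)"] ef unfolding 1 2
              by (simp add: w_def sum.cartesian_product' distrib_left sum.distrib)
          qed
        qed
        then show False using Xg[OF p] e
          by (simp add: W_def g_def sum.cartesian_product')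
      qed
      then show ?thesis unfolding V_def by (rule for_generic_mono) simp
    qed (use E S wpoly gpoly e in auto)
  qed
qed


section \<open>Configurations in general position\<close>

definition general_position :: "'v set \<Rightarrow> ('v \<Rightarrow> real^'d) \<Rightarrow> bool" where
  "general_position V p \<longleftrightarrow> (\<forall>v\<in>V. \<forall>u :: 'd \<Rightarrow> 'v.
     inj u \<and> range u \<subseteq> V - {v} \<longrightarrow> det (\<chi> i. p (u i) - p v) \<noteq> 0)"

lemma generic_general_position:
  assumes "finite V"
  shows "for_generic V (\<lambda>p :: 'v \<Rightarrow> real^'d. general_position V p)"
proof -
  define S where "S = {vu :: 'v \<times> ('d \<Rightarrow> 'v). fst vu \<in> V \<and> inj (snd vu) \<and> range (snd vu) \<subseteq> V - {fst vu}}"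
  have "S \<subseteq> V \<times> PiE UNIV (\<lambda>_. V)" by (auto simp: S_def)
  then have "finite S"
    by (rule finite_subset) (use assms in \<open>auto intro!: finite_PiE\<close>)
  then have "for_generic V (\<lambda>p :: 'v \<Rightarrow> real^'d. \<forall>vu\<in>S. det (\<chi> i. p (snd vu i) - p (fst vu)) \<noteq> 0)"
  proof (rule for_generic_ball)
    fix vu assume vu: "vu \<in> S"
    define v u where "v = fst vu" and "u = snd vu"
    have vu: "v \<in> V" "inj u" "range u \<subseteq> V" "v \<notin> range u" using vu by (auto simp: S_def u_def v_def)
    show "for_generic V (\<lambda>p :: 'v \<Rightarrow> real^'d. det (\<chi> i. p (snd vu i) - p (fst vu)) \<noteq> 0)"
      unfolding u_def[symmetric] v_def[symmetric]
    proof (rule for_genericI)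
      show "rat_poly_fun V (\<lambda>p :: 'v \<Rightarrow> real^'d. det (\<chi> i. p (u i) - p v))"
        unfolding det_def using vu by (intro rat_poly_fun_intros) (auto intro!: rat_poly_fun_intros)
      define q :: "'v \<Rightarrow> real^'d" where "q = (\<lambda>x. if x \<in> range u then axis (inv u x) 1 else 0)"
      have "(\<chi> i. q (u i) - q v) = mat 1"
        using vu by (simp add: q_def vec_eq_iff mat_def axis_def)
      moreover have "q \<in> vectors_on V" using vu by (auto simp: q_def vectors_on_def)
      ultimately show "nonzero_on V (\<lambda>p :: 'v \<Rightarrow> real^'d. det (\<chi> i. p (u i) - p v))"
        unfolding nonzero_on_def by (intro bexI[of _ q]) simp_all
    qed
  qed
  then show ?thesis
    by (rule for_generic_mono) (force simp: general_position_def S_def)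
qed

lemma
  fixes r :: "'d::finite \<Rightarrow> real^'d"
  assumes "det (\<chi> i. r i) \<noteq> 0"
  shows det_nz_solve: "\<exists>n. \<forall>i. r i \<bullet> n = b i"
    and det_nz_inner_zero: "(\<forall>i. r i \<bullet> z = 0) \<Longrightarrow> z = 0"
    and det_nz_span: "\<exists>c. y = (\<Sum>i\<in>UNIV. c i *\<^sub>R r i)"
    and det_nz_independent: "(\<Sum>i\<in>UNIV. c i *\<^sub>R r i) = 0 \<Longrightarrow> c i = 0"
proof -
  define M where "M = (\<chi> i. r i)"
  have M: "invertible M" "invertible (transpose M)"
    using assms by (simp_all add: M_def invertible_det_nz det_transpose)
  have Mi: "(M *v n) $ i = r i \<bullet> n" for n i
    by (simp add: M_def matrix_vector_mul_component)
  have Mt: "transpose M *v c = (\<Sum>i\<in>UNIV. c $ i *\<^sub>R r i)" for c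
    by (simp add: matrix_mult_sum M_def row_def scalar_mult_eq_scaleR)
  show "\<exists>n. \<forall>i. r i \<bullet> n = b i"
  proof -
    obtain n where "M *v n = (\<chi> i. b i)"
      using M(1) by (metis invertible_def matrix_vector_mul_assoc matrix_vector_mul_lid)
    then have "r i \<bullet> n = b i" for i using Mi[of n i] by simp
    then show ?thesis by blast
  qed
  show "z = 0" if "\<forall>i. r i \<bullet> z = 0"
  proof -
    have "M *v z = 0" using that Mi[of z] by (simp add: vec_eq_iff)
    then show ?thesis using M(1) matrix_left_invertible_ker invertible_def by metis
  qed
  show "\<exists>c. y = (\<Sum>i\<in>UNIV. c i *\<^sub>R r i)"
  proof -
    obtain c where "transpose M *v c = y"
      using M(2) by (metis invertible_def matrix_vector_mul_assoc matrix_vector_mul_lid)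
    then show ?thesis using Mt by (intro exI[of _ "\<lambda>i. c $ i"]) simp
  qed
  show "c i = 0" if "(\<Sum>i\<in>UNIV. c i *\<^sub>R r i) = 0"
  proof -
    have "transpose M *v (\<chi> i. c i) = 0" unfolding Mt using that by simp
    then have "(\<chi> i. c i) = 0" using M(2) matrix_left_invertible_ker invertible_def by metis
    then show ?thesis by (simp add: vec_eq_iff)
  qed
qed


section \<open>Adding a source of out-degree at least the dimension\<close>

definition delete_vertex :: "'v pair_pre_digraph \<Rightarrow> 'v \<Rightarrow> 'v pair_pre_digraph" where
  "delete_vertex G v = \<lparr>pverts = pverts G - {v}, parcs = {e \<in> parcs G. fst e \<noteq> v \<and> snd e \<noteq> v}\<rparr>"

text \<open>
  One step of a stable root extension at a fixed configuration \<open>p\<close>; the vertices \<open>u i\<close> are \<open>d\<close> of the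
  out-neighbours of \<open>v\<close>, so that the vectors \<open>p (u i) - p v\<close> form a basis.
\<close>

locale source_extension =
  fixes G :: "'v pair_pre_digraph" and v :: 'v and p :: "'v \<Rightarrow> real^'d" and u :: "'d \<Rightarrow> 'v"
  assumes G: "pair_digraph G"
    and v: "v \<in> pverts G"
    and source: "\<And>x. (x, v) \<notin> parcs G"
    and gp: "general_position (pverts G) p"
    and u: "inj u" "\<And>i. (v, u i) \<in> parcs G"
begin

abbreviation G' where "G' \<equiv> delete_vertex G v"

definition N where "N = {w. (v, w) \<in> parcs G}"

lemma pverts_G': "pverts G' = pverts G - {v}"
  by (simp add: delete_vertex_def)

lemma parcs_G_cases:
  assumes "e \<in> parcs G"
  obtains "e \<in> parcs G'" | w where "w \<in> N" "e = (v, w)"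
  using assms source[of "fst e"] by (cases e) (auto simp: delete_vertex_def N_def)

lemma parcs_G: "parcs G = parcs G' \<union> {v} \<times> N"
  using source by (auto simp: delete_vertex_def N_def)

lemma N_verts: "w \<in> N \<Longrightarrow> w \<in> pverts G \<and> w \<noteq> v"
  using pair_loopfree_digraph.pair_no_loops[of G "(v, w)"] pair_wf_digraph.arc_snd_in_verts[of G "(v, w)"]
    G source[of v]
  by (auto simp: N_def pair_digraph_def pair_fin_digraph_def)

lemma parcs_G'_verts:
  assumes "e \<in> parcs G'" shows "fst e \<in> pverts G'" "snd e \<in> pverts G'" "e \<in> parcs G" "fst e \<noteq> v" "snd e \<noteq> v"
  using assms pair_wf_digraph.arc_fst_in_verts[of G e] pair_wf_digraph.arc_snd_in_verts[of G e] G
  by (auto simp: delete_vertex_def pair_digraph_def pair_fin_digraph_def)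

lemma uN: "u i \<in> N"
  using u by (simp add: N_def)

lemma finite_N: "finite N"
proof (rule finite_subset)
  show "N \<subseteq> pverts G" using N_verts by blast
  show "finite (pverts G)"
    using G by (simp add: pair_digraph_def pair_fin_digraph_def pair_fin_digraph_axioms_def)
qed

lemma G': "pair_digraph G'"
proof -
  interpret pair_digraph G by (rule G)
  show ?thesis
    using arc_fst_in_verts arc_snd_in_verts pair_no_loops
    by unfold_locales (auto simp: delete_vertex_def pair_finite_verts pair_finite_arcs)
qed

lemma det_v: "det (\<chi> i. p (u i) - p v) \<noteq> 0"
proof -
  have "range u \<subseteq> pverts G - {v}" using N_verts[OF uN] by auto
  then show ?thesis using gp u v unfolding general_position_def by blast
qed

lemma det_w:
  assumes "w \<in> N" "w \<notin> range u" shows "det (\<chi> i. p (u i) - p w) \<noteq> 0"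
proof -
  have "range u \<subseteq> pverts G - {w}" using assms N_verts[OF uN] by auto
  then show ?thesis using gp u N_verts[OF assms(1)] unfolding general_position_def by blast
qed

text \<open>
  The distances to \<open>d\<close> neighbours in general position leave two places for \<open>v\<close>, interchanged by the
  reflection in their hyperplane. If all other vertices lie on that hyperplane the reflection is a
  congruence; otherwise the distance to a vertex off it separates the two places.
\<close>

lemma locally_rigid_extend:
  assumes p: "p \<in> vectors_on (pverts G)" and rigid: "locally_rigid G' (restrict_config (pverts G') p)"
  shows "locally_rigid G p"
proof -
  define V' where "V' = pverts G'"
  define p' where "p' = restrict_config V' p"
  have p': "p' w = p w" if "w \<in> V'" for w using that by (simp add: p'_def restrict_config_def)
  obtain \<epsilon> where \<epsilon>: "\<epsilon> > 0" "\<And>q. q \<in> vectors_on V' \<Longrightarrow> \<forall>w\<in>V'. dist (q w) (p' w) < \<epsilon> \<Longrightarrow>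
      distance_map G' q = distance_map G' p' \<Longrightarrow> congruent_on V' p' q"
    using rigid unfolding locally_rigid_def V'_def p'_def by blast
  obtain n where n: "\<And>i. (p (u i) - p v) \<bullet> n = 1"
    using det_nz_solve[OF det_v, of "\<lambda>_. 1"] by blast
  have n0: "n \<bullet> n > 0" using n[of undefined] by (auto simp: inner_gt_zero_iff)
  define z where "z = (2 / (n \<bullet> n)) *\<^sub>R n"
  define refl where "refl = (\<lambda>x. x - (2 * ((x - p v) \<bullet> n - 1) / (n \<bullet> n)) *\<^sub>R n)"
  have refl_v: "refl (p v) = p v + z" by (simp add: refl_def z_def)
  have refl_dist: "dist (refl x) (refl y) = dist x y" for x y
  proof -
    define t where "t = 2 * ((x - y) \<bullet> n) / (n \<bullet> n)"
    have d: "refl x - refl y = (x - y) - t *\<^sub>R n"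
      by (simp add: refl_def t_def algebra_simps diff_divide_distrib add_divide_distrib)
    have "(refl x - refl y) \<bullet> (refl x - refl y) = (x - y) \<bullet> (x - y) - 2 * t * ((x - y) \<bullet> n) + t * (t * (n \<bullet> n))"
      unfolding d by (simp add: inner_diff_left inner_diff_right inner_commute algebra_simps)
    also have "t * (n \<bullet> n) = 2 * ((x - y) \<bullet> n)" using n0 by (simp add: t_def)
    finally show ?thesis by (simp add: dist_norm norm_eq)
  qed
  \<comment> \<open>a vertex off the hyperplane is at different distances from the two places\<close>
  have sep: "\<exists>\<delta>>0. (\<exists>w\<in>V'. (p w - p v) \<bullet> n \<noteq> 1) \<longrightarrow>
      (\<exists>w\<in>V'. \<delta> \<le> \<bar>dist (p v + z) (p w) - dist (p v) (p w)\<bar>)"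
  proof (cases "\<exists>w\<in>V'. (p w - p v) \<bullet> n \<noteq> 1")
    case True
    then obtain w where w: "w \<in> V'" "(p w - p v) \<bullet> n \<noteq> 1" by blast
    define s where "s = (p w - p v) \<bullet> n"
    have "(dist (p v + z) (p w))\<^sup>2 - (dist (p v) (p w))\<^sup>2 = z \<bullet> z - 2 * (z \<bullet> (p w - p v))"
      by (simp add: dist_norm power2_norm_eq_inner inner_diff_left inner_diff_right
        inner_add_left inner_add_right inner_commute algebra_simps)
    also have "\<dots> = 4 * (1 - s) / (n \<bullet> n)"
      using n0 by (simp add: z_def s_def inner_commute field_simps)
    finally have "(dist (p v + z) (p w))\<^sup>2 - (dist (p v) (p w))\<^sup>2 \<noteq> 0" using w n0 by (simp add: s_def)
    then have "dist (p v + z) (p w) \<noteq> dist (p v) (p w)" by auto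
    then show ?thesis using w
      by (intro exI[of _ "\<bar>dist (p v + z) (p w) - dist (p v) (p w)\<bar>"]) auto
  qed (auto intro: exI[of _ 1])
  then obtain \<delta> where \<delta>: "\<delta> > 0" "(\<exists>w\<in>V'. (p w - p v) \<bullet> n \<noteq> 1) \<Longrightarrow>
      (\<exists>w\<in>V'. \<delta> \<le> \<bar>dist (p v + z) (p w) - dist (p v) (p w)\<bar>)" by blast
  show ?thesis
    unfolding locally_rigid_def
  proof (intro exI[of _ "min \<epsilon> (\<delta> / 2)"] conjI ballI impI)
    show "min \<epsilon> (\<delta> / 2) > 0" using \<epsilon> \<delta> by simp
    fix q assume q: "q \<in> vectors_on (pverts G)" "\<forall>w\<in>pverts G. dist (q w) (p w) < min \<epsilon> (\<delta> / 2)"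
      and dm: "distance_map G q = distance_map G p"
    have arc: "dist (q a) (q b) = dist (p a) (p b)" if "(a, b) \<in> parcs G" for a b
      using fun_cong[OF dm, of "(a, b)"] that by (simp add: distance_map_def dist_norm norm_minus_commute)
    define q' where "q' = restrict_config V' q"
    have q': "q' w = q w" if "w \<in> V'" for w using that by (simp add: q'_def restrict_config_def)
    have "congruent_on V' p' q'"
    proof (rule \<epsilon>)
      show "q' \<in> vectors_on V'" by (simp add: q'_def restrict_config_in_vectors_on)
      show "\<forall>w\<in>V'. dist (q' w) (p' w) < \<epsilon>" using q(2) by (auto simp: p' q') (auto simp: V'_def pverts_G')
      show "distance_map G' q' = distance_map G' p'"
      proof (rule ext)
        fix e
        show "distance_map G' q' e = distance_map G' p' e"
        proof (cases "e \<in> parcs G'")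
          case True
          then have "fst e \<in> V'" "snd e \<in> V'" "(fst e, snd e) \<in> parcs G"
            using parcs_G'_verts[OF True] by (auto simp: V'_def)
          then show ?thesis using True arc[of "fst e" "snd e"]
            by (cases e) (simp add: distance_map_def p' q' dist_norm norm_minus_commute)
        qed (cases e, simp add: distance_map_def)
      qed
    qed
    then obtain f where f: "\<And>x y. dist (f x) (f y) = dist x y" "\<And>w. w \<in> V' \<Longrightarrow> q w = f (p w)"
      unfolding congruent_on_def using p' q' by metis
    have "surj f"
    proof -
      have "orthogonal_transformation (\<lambda>x. f x - f 0)"
        using f(1) by (simp add: orthogonal_transformation_isometry dist_norm)
      then have s: "surj (\<lambda>x. f x - f 0)" by (rule orthogonal_transformation_surj)
      have "\<exists>x. y = f x" for y using surjD[OF s, of "y - f 0"] by (auto simp: algebra_simps)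
      then show ?thesis by (auto simp: surj_def)
    qed
    then obtain y where y: "q v = f y" by (metis surjD)
    have yN: "dist y (p w) = dist (p v) (p w)" if "w \<in> N" for w
    proof -
      have "w \<in> V'" using N_verts[OF that] by (simp add: V'_def pverts_G')
      then have "dist y (p w) = dist (q v) (q w)" by (simp add: y f)
      then show ?thesis using arc[of v w] that by (simp add: N_def)
    qed
    define x where "x = y - p v"
    have xr: "(p (u i) - p v) \<bullet> x = (x \<bullet> x) / 2" for i
    proof -
      have "(y - p (u i)) \<bullet> (y - p (u i)) = (p v - p (u i)) \<bullet> (p v - p (u i))"
        using yN[OF uN, of i] by (simp add: dist_norm norm_eq)
      moreover have "y = p v + x" by (simp add: x_def)
      ultimately show ?thesis
        by (simp add: inner_diff_left inner_diff_right inner_add_left inner_add_right inner_commute algebra_simps)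
    qed
    have xn: "x = ((x \<bullet> x) / 2) *\<^sub>R n"
    proof -
      have "x - ((x \<bullet> x) / 2) *\<^sub>R n = 0"
        by (rule det_nz_inner_zero[OF det_v]) (simp add: inner_diff_right xr n)
      then show ?thesis by simp
    qed
    have y2: "y = p v \<or> y = p v + z"
    proof -
      define s where "s = (x \<bullet> x) / 2"
      have "x \<bullet> x = (s *\<^sub>R n) \<bullet> (s *\<^sub>R n)" using xn by (simp add: s_def)
      then have "2 * s = s * (s * (n \<bullet> n))" by (simp add: s_def)
      then have "s = 0 \<or> s = 2 / (n \<bullet> n)" using n0 by (auto simp: field_simps)
      then have "x = 0 \<or> x = z" using xn by (auto simp: s_def[symmetric] z_def)
      then show ?thesis by (auto simp: x_def algebra_simps)
    qed
    show "congruent_on (pverts G) p q"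
    proof (cases "y = p v")
      case True
      then show ?thesis using f y unfolding congruent_on_def
        by (intro exI[of _ f]) (auto simp: V'_def pverts_G')
    next
      case False
      then have yz: "y = p v + z" using y2 by simp
      have "\<not> (\<exists>w\<in>V'. (p w - p v) \<bullet> n \<noteq> 1)"
      proof
        assume "\<exists>w\<in>V'. (p w - p v) \<bullet> n \<noteq> 1"
        then obtain w where w: "w \<in> V'" "\<delta> \<le> \<bar>dist (p v + z) (p w) - dist (p v) (p w)\<bar>"
          using \<delta> by blast
        have "dist (p v + z) (p w) = dist (q v) (q w)" using f w y by (simp add: yz)
        moreover have "dist (q v) (p v) < \<delta> / 2" "dist (q w) (p w) < \<delta> / 2"
          using q(2) v w by (auto simp: V'_def pverts_G')
        moreover have "dist (q v) (q w) \<le> dist (q v) (p v) + dist (p v) (p w) + dist (q w) (p w)"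
          using dist_triangle[of "q v" "q w" "p v"] dist_triangle[of "p v" "q w" "p w"]
          by (simp add: dist_commute)
        moreover have "dist (p v) (p w) \<le> dist (q v) (p v) + dist (q v) (q w) + dist (q w) (p w)"
          using dist_triangle[of "p v" "p w" "q v"] dist_triangle[of "q v" "p w" "q w"]
          by (simp add: dist_commute)
        ultimately show False using w(2) by linarith
      qed
      then have fix_H: "refl (p w) = p w" if "w \<in> V'" for w
        using that by (auto simp: refl_def)
      show ?thesis unfolding congruent_on_def
      proof (intro exI[of _ "f \<circ> refl"] conjI allI ballI)
        show "dist ((f \<circ> refl) x) ((f \<circ> refl) y) = dist x y" for x y by (simp add: f refl_dist)
        show "q w = (f \<circ> refl) (p w)" if "w \<in> pverts G" for w
          using that f(2)[of w] fix_H[of w] y yz refl_v by (cases "w = v") (auto simp: V'_def pverts_G')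
      qed
    qed
  qed
qed

text \<open>
  A flex of \<open>G'\<close> is infinitesimally isometric on all of its vertices. It extends over \<open>v\<close> compatibly
  with \<open>d\<close> neighbours, and then automatically with any further neighbour \<open>w\<close>: if
  \<open>p w - p v = (\<Sum>i. c i *\<^sub>R (p (u i) - p v))\<close>, the pairwise conditions give \<open>s * ((\<Sum>i. c i) - 1) = 0\<close>
  for the violation \<open>s\<close> at \<open>w\<close>, and the second factor is non-zero because \<open>w\<close> is off the hyperplane
  of the \<open>p (u i)\<close>.
\<close>

lemma flex_extends:
  assumes rigid: "infinitesimally_rigid G' p" and x: "\<forall>e\<in>parcs G'. stretch p x e = 0"
  shows "\<exists>y. \<forall>w\<in>N. (p v - p w) \<bullet> (y - x w) = 0"
proof -
  have pair: "(p a - p b) \<bullet> (x a - x b) = 0" if "a \<in> N" "b \<in> N" for a b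
    using rigid x that N_verts unfolding infinitesimally_rigid_def
    by (force simp: stretch_def pverts_G')
  define r where "r = (\<lambda>w. p w - p v)"
  obtain y where y: "\<And>i. r (u i) \<bullet> y = r (u i) \<bullet> x (u i)"
    using det_nz_solve[OF det_v, of "\<lambda>i. r (u i) \<bullet> x (u i)"] by (auto simp: r_def)
  define t where "t = (\<lambda>w. x w - y)"
  have rt: "r (u i) \<bullet> t (u i) = 0" for i using y[of i] by (simp add: t_def inner_diff_right)
  have cross: "(r a - r b) \<bullet> (t a - t b) = 0" if "a \<in> N" "b \<in> N" for a b
    using pair[OF that] by (simp add: r_def t_def)
  have "r w \<bullet> t w = 0" if w: "w \<in> N" for w
  proof (cases "w \<in> range u")
    case True
    then show ?thesis using rt by auto
  next
    case False
    obtain c where c: "r w = (\<Sum>i\<in>UNIV. c i *\<^sub>R r (u i))"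
      using det_nz_span[OF det_v, of "r w"] by (auto simp: r_def)
    define s where "s = r w \<bullet> t w"
    have c_inner: "r w \<bullet> z = (\<Sum>i\<in>UNIV. c i * (r (u i) \<bullet> z))" for z
      unfolding c by (simp add: inner_sum_left)
    define A where "A = (\<Sum>i\<in>UNIV. c i * (r w \<bullet> t (u i)))"
    have "A = (\<Sum>i\<in>UNIV. \<Sum>j\<in>UNIV. c i * c j * (r (u j) \<bullet> t (u i)))"
      by (simp add: A_def c_inner sum_distrib_left mult_ac)
    also have "\<dots> = (\<Sum>i\<in>UNIV. \<Sum>j\<in>UNIV. - (c i * c j * (r (u i) \<bullet> t (u j))))"
    proof (intro sum.cong refl)
      fix i j
      have "r (u j) \<bullet> t (u i) = - (r (u i) \<bullet> t (u j))"
        using cross[OF uN uN, of i j] rt[of i] rt[of j] by (simp add: inner_diff_left inner_diff_right)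
      then show "c i * c j * (r (u j) \<bullet> t (u i)) = - (c i * c j * (r (u i) \<bullet> t (u j)))" by simp
    qed
    also have "\<dots> = - (\<Sum>j\<in>UNIV. \<Sum>i\<in>UNIV. c i * c j * (r (u i) \<bullet> t (u j)))"
      by (subst sum.swap) (simp add: sum_negf)
    also have "\<dots> = - A"
      by (simp add: A_def c_inner sum_distrib_left mult_ac)
    finally have A0: "A = 0" by simp
    have "s - r w \<bullet> t (u i) - r (u i) \<bullet> t w = 0" for i
      using cross[OF w uN, of i] rt[of i] by (simp add: s_def inner_diff_left inner_diff_right)
    then have "0 = (\<Sum>i\<in>UNIV. c i * (s - r w \<bullet> t (u i) - r (u i) \<bullet> t w))" by simp
    also have "\<dots> = s * (\<Sum>i\<in>UNIV. c i) - A - (\<Sum>i\<in>UNIV. c i * (r (u i) \<bullet> t w))"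
      by (simp add: right_diff_distrib sum_subtractf A_def sum_distrib_left mult_ac)
    also have "(\<Sum>i\<in>UNIV. c i * (r (u i) \<bullet> t w)) = s"
      by (simp add: s_def c_inner)
    finally have s0: "s = 0 \<or> (\<Sum>i\<in>UNIV. c i) = 1" using A0
      by (simp add: algebra_simps)
    have "(\<Sum>i\<in>UNIV. c i) \<noteq> 1"
    proof
      assume c1: "(\<Sum>i\<in>UNIV. c i) = 1"
      have "(\<Sum>i\<in>UNIV. c i *\<^sub>R (p (u i) - p w)) = (\<Sum>i\<in>UNIV. c i *\<^sub>R r (u i) - c i *\<^sub>R r w)"
        by (intro sum.cong refl) (simp add: r_def algebra_simps)
      also have "\<dots> = r w - (\<Sum>i\<in>UNIV. c i) *\<^sub>R r w"
        by (simp add: sum_subtractf c[symmetric] scaleR_sum_left)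
      finally have "(\<Sum>i\<in>UNIV. c i *\<^sub>R (p (u i) - p w)) = 0" using c1 by simp
      then have "c i = 0" for i by (rule det_nz_independent[OF det_w[OF w False]])
      then show False using c1 by simp
    qed
    then show ?thesis using s0 by (simp add: s_def)
  qed
  then show ?thesis
    by (intro exI[of _ y]) (auto simp: r_def t_def inner_diff_left inner_diff_right algebra_simps)
qed

definition restr :: "('v \<times> 'v \<Rightarrow> real) \<Rightarrow> 'v \<times> 'v \<Rightarrow> real" where
  "restr w = (\<lambda>e. if e \<in> parcs G' then w e else 0)"

lemma restr_in_image:
  assumes "w \<in> rigidity_image G p" shows "restr w \<in> rigidity_image G' p"
proof -
  obtain x where "w = (\<lambda>e. if e \<in> parcs G then stretch p x e else 0)"
    using assms by (auto simp: rigidity_image_iff[OF G])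
  then show ?thesis unfolding rigidity_image_iff[OF G']
    by (intro exI[of _ x]) (auto simp: restr_def parcs_G)
qed

lemma finite_arcs: "finite (parcs G)"
  using G by (simp add: pair_digraph_def pair_fin_digraph_def pair_fin_digraph_axioms_def)

lemma tail_load_other:
  assumes "x \<noteq> v" shows "tail_load G p w x = tail_load G' p (restr w) x"
proof -
  have "tail_load G p w x = (\<Sum>e\<in>parcs G'. if fst e = x then w e *\<^sub>R (p x - p (snd e)) else 0)"
    unfolding tail_load_def using finite_arcs assms
    by (intro sum.mono_neutral_right) (auto simp: parcs_G)
  also have "\<dots> = tail_load G' p (restr w) x"
    unfolding tail_load_def by (intro sum.cong) (auto simp: restr_def)
  finally show ?thesis .
qed

lemma tail_load_source: "tail_load G p w v = (\<Sum>h\<in>N. w (v, h) *\<^sub>R (p v - p h))"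
proof -
  have "tail_load G p w v = (\<Sum>e\<in>{v} \<times> N. w e *\<^sub>R (p v - p (snd e)))"
    unfolding tail_load_def using finite_arcs parcs_G'_verts(4)
    by (intro sum.mono_neutral_cong_right) (auto simp: parcs_G)
  also have "\<dots> = (\<Sum>h\<in>N. w (v, h) *\<^sub>R (p v - p h))"
    by (simp add: sum.cartesian_product')
  finally show ?thesis .
qed

text \<open>
  The block triangular form of the edge operator: arcs at \<open>v\<close> load only their tail \<open>v\<close>, which is not an
  end of any arc of \<open>G'\<close>.
\<close>

lemma edge_operator_restr:
  assumes "e \<in> parcs G'" shows "edge_operator G p w e = edge_operator G' p (restr w) e"
  using assms parcs_G'_verts[OF assms] tail_load_other[of "fst e" w] tail_load_other[of "snd e" w]
  by (cases e) (simp add: edge_operator_stretch[OF G] edge_operator_stretch[OF G'] stretch_def)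

lemma edge_operator_fibre:
  assumes "restr w = (\<lambda>_. 0)" "h \<in> N"
  shows "edge_operator G p w (v, h) = 2 * ((p v - p h) \<bullet> tail_load G p w v)"
proof -
  have "tail_load G p w h = 0"
    using tail_load_other[of h w] N_verts[OF assms(2)] assms(1)
    by (auto simp: tail_load_def intro!: sum.neutral)
  then show ?thesis using assms(2) by (simp add: edge_operator_stretch[OF G] stretch_def parcs_G)
qed

lemma restr_zeroD: "restr w = (\<lambda>_. 0) \<Longrightarrow> e \<in> parcs G' \<Longrightarrow> w e = 0"
  by (drule fun_cong[of _ _ e]) (simp add: restr_def)

text \<open>
  If \<open>R x\<close> vanishes on \<open>G'\<close>, then \<open>x\<close> is a flex of \<open>G'\<close>; subtracting its extension over \<open>v\<close> leaves a
  motion of \<open>v\<close> alone.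
\<close>

lemma image_fibre:
  assumes rigid: "infinitesimally_rigid G' p" and w: "w \<in> rigidity_image G p" "restr w = (\<lambda>_. 0)"
  shows "\<exists>z. \<forall>h\<in>N. w (v, h) = (p v - p h) \<bullet> z"
proof -
  obtain x where x: "w = (\<lambda>e. if e \<in> parcs G then stretch p x e else 0)"
    using w by (auto simp: rigidity_image_iff[OF G])
  have "\<forall>e\<in>parcs G'. stretch p x e = 0"
    using restr_zeroD[OF w(2)] by (auto simp: x parcs_G split: if_splits)
  then obtain y where y: "\<And>h. h \<in> N \<Longrightarrow> (p v - p h) \<bullet> (y - x h) = 0"
    using flex_extends[OF rigid] by blast
  have "w (v, h) = (p v - p h) \<bullet> (x v - y)" if "h \<in> N" for h
    using y[OF that] that by (simp add: x parcs_G stretch_def inner_diff_right)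
  then show ?thesis by blast
qed

lemma fibre_in_image:
  "(\<lambda>e. if e \<in> {v} \<times> N then (p v - p (snd e)) \<bullet> z else 0) \<in> rigidity_image G p"
  unfolding rigidity_image_iff[OF G]
proof (intro exI[of _ "\<lambda>x. if x = v then z else 0"] ext)
  fix e
  show "(if e \<in> {v} \<times> N then (p v - p (snd e)) \<bullet> z else 0) =
    (if e \<in> parcs G then stretch p (\<lambda>x. if x = v then z else 0) e else 0)"
    using N_verts parcs_G'_verts(4,5)[of e] by (cases e) (auto simp: parcs_G stretch_def)
qed

text \<open>
  On the fibre the edge operator is \<open>2 A A\<^sup>T\<close> on the image of \<open>A\<close>, where \<open>A\<close> has rows \<open>p v - p h\<close>,
  and the load at \<open>v\<close> is \<open>A\<^sup>T w\<close>; for \<open>w = A z\<close>, \<open>A\<^sup>T w = 0\<close> gives \<open>w \<bullet> w = z \<bullet> A\<^sup>T w = 0\<close>.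
\<close>

lemma fibre_load_nonzero:
  assumes "infinitesimally_rigid G' p" "w \<in> rigidity_image G p" "restr w = (\<lambda>_. 0)"
    and load: "tail_load G p w v = 0"
  shows "w = (\<lambda>_. 0)"
proof
  obtain z where z: "\<And>h. h \<in> N \<Longrightarrow> w (v, h) = (p v - p h) \<bullet> z"
    using image_fibre[OF assms(1-3)] by blast
  have "(\<Sum>h\<in>N. w (v, h) * w (v, h)) = (\<Sum>h\<in>N. w (v, h) *\<^sub>R (p v - p h)) \<bullet> z"
    by (simp add: inner_sum_left z)
  then have "\<forall>h\<in>N. w (v, h) = 0"
    using load finite_N by (simp add: tail_load_source sum_nonneg_eq_0_iff)
  then show "w e = 0" for e
    using restr_zeroD[OF assms(3), of e] rigidity_image_outside[OF assms(2), of e] by (auto simp: parcs_G)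
qed

text \<open>
  Block triangular operators are invertible when the diagonal blocks are; the second block is
  \<open>2 A A\<^sup>T\<close>, and it maps \<open>A z\<close> to \<open>A y\<close> when \<open>2 A\<^sup>T A z = y\<close>, where \<open>T\<close> below is \<open>A\<^sup>T A\<close>.
\<close>

lemma bij_extend:
  assumes rigid: "infinitesimally_rigid G' p"
    and bij: "bij_betw (edge_operator G' p) (rigidity_image G' p) (rigidity_image G' p)"
  shows "bij_betw (edge_operator G p) (rigidity_image G p) (rigidity_image G p)"
proof -
  have op_diff: "edge_operator G p (\<lambda>e. x e - y e) = (\<lambda>e. edge_operator G p x e - edge_operator G p y e)" for x y :: "'v \<times> 'v \<Rightarrow> real"
    by (simp add: edge_operator_def fun_eq_iff right_diff_distrib sum_subtractf)
  have inj: "w = (\<lambda>_. 0)" if w: "w \<in> rigidity_image G p" "edge_operator G p w = (\<lambda>_. 0)" for w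
  proof -
    have "edge_operator G' p (restr w) = (\<lambda>_. 0)"
    proof
      fix e
      show "edge_operator G' p (restr w) e = 0"
        using edge_operator_restr[of e w] fun_cong[OF w(2), of e]
        by (cases "e \<in> parcs G'") (simp, simp add: edge_operator_def)
    qed
    then have r0: "restr w = (\<lambda>_. 0)"
      using inj_onD[OF bij_betw_imp_inj_on[OF bij], of "restr w" "\<lambda>_. 0"]
        restr_in_image[OF w(1)] rigidity_image_zero[OF G', of p] by (simp add: edge_operator_zero)
    have "(p (u i) - p v) \<bullet> tail_load G p w v = 0" for i
      using edge_operator_fibre[OF r0 uN, of i] w(2) by (simp add: inner_diff_left)
    then have "tail_load G p w v = 0" by (intro det_nz_inner_zero[OF det_v]) simp
    then show ?thesis by (rule fibre_load_nonzero[OF rigid w(1) r0])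
  qed
  have "inj_on (edge_operator G p) (rigidity_image G p)"
  proof (rule inj_onI)
    fix x y assume xy: "x \<in> rigidity_image G p" "y \<in> rigidity_image G p"
      "edge_operator G p x = edge_operator G p y"
    have "edge_operator G p (\<lambda>e. x e - y e) = (\<lambda>_. 0)" using xy(3) by (simp add: op_diff)
    then have "(\<lambda>e. x e - y e) = (\<lambda>_. 0)" by (rule inj[OF rigidity_image_diff[OF G xy(1,2)]])
    then show "x = y" by (simp add: fun_eq_iff)
  qed
  moreover have "w \<in> edge_operator G p ` rigidity_image G p" if w: "w \<in> rigidity_image G p" for w
  proof -
    obtain a where a: "a \<in> rigidity_image G' p" "edge_operator G' p a = restr w"
      using bij restr_in_image[OF w] unfolding bij_betw_def by (metis imageE)
    obtain x where x: "a = (\<lambda>e. if e \<in> parcs G' then stretch p x e else 0)"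
      using a(1) by (auto simp: rigidity_image_iff[OF G'])
    define b where "b = (\<lambda>e. if e \<in> parcs G then stretch p x e else 0)"
    have b: "b \<in> rigidity_image G p" unfolding rigidity_image_iff[OF G] b_def by blast
    have rb: "restr b = a" by (auto simp: restr_def b_def x parcs_G)
    define d where "d = (\<lambda>e. w e - edge_operator G p b e)"
    have d: "d \<in> rigidity_image G p"
      unfolding d_def by (intro rigidity_image_diff[OF G] w edge_operator_in_rigidity_image)
    have rd: "restr d = (\<lambda>_. 0)"
    proof
      fix e show "restr d e = 0"
        using fun_cong[OF a(2), of e] edge_operator_restr[of e b]
        by (cases "e \<in> parcs G'") (simp_all add: rb, simp_all add: restr_def d_def)
    qed
    obtain y where y: "\<And>h. h \<in> N \<Longrightarrow> d (v, h) = (p v - p h) \<bullet> y"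
      using image_fibre[OF rigid d rd] by blast
    define T where "T = (\<lambda>z. \<Sum>h\<in>N. ((p v - p h) \<bullet> z) *\<^sub>R (p v - p h))"
    have T: "linear T"
      by (rule linearI) (simp_all add: T_def inner_add_right scaleR_add_left sum.distrib scaleR_sum_right)
    have "z = 0" if "T z = 0" for z
    proof -
      have "(\<Sum>h\<in>N. ((p v - p h) \<bullet> z) * ((p v - p h) \<bullet> z)) = T z \<bullet> z"
        by (simp add: T_def inner_sum_left)
      then have "\<forall>h\<in>N. (p v - p h) \<bullet> z = 0" using that finite_N by (simp add: sum_nonneg_eq_0_iff)
      then have "(p (u i) - p v) \<bullet> z = 0" for i using uN[of i] by (simp add: inner_diff_left)
      then show ?thesis by (intro det_nz_inner_zero[OF det_v]) simp
    qed
    then have "inj T" using T by (simp add: linear_injective_0)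
    then have "surj T" using T linear_injective_imp_surjective by blast
    then obtain z where z: "T z = (1 / 2) *\<^sub>R y" by (metis surjD)
    define c where "c = (\<lambda>e. if e \<in> {v} \<times> N then (p v - p (snd e)) \<bullet> z else 0)"
    have c: "c \<in> rigidity_image G p" unfolding c_def by (rule fibre_in_image)
    have rc: "restr c = (\<lambda>_. 0)" using parcs_G'_verts(4) by (auto simp: restr_def c_def)
    have lc: "tail_load G p c v = T z" by (simp add: tail_load_source c_def T_def)
    have "edge_operator G p c e = d e" for e
    proof (cases "e \<in> parcs G")
      case True
      then show ?thesis
      proof (cases rule: parcs_G_cases)
        case 1
        then show ?thesis using edge_operator_restr[OF 1, of c] restr_zeroD[OF rd 1]
          by (simp add: rc edge_operator_zero)
      next
        case (2 h)
        then show ?thesis using edge_operator_fibre[OF rc, of h] y[of h] by (simp add: lc z)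
      qed
    next
      case False
      then show ?thesis using rigidity_image_outside[OF d] by (simp add: edge_operator_def)
    qed
    then have "edge_operator G p (\<lambda>e. b e + c e) = w"
      by (simp add: edge_operator_add fun_eq_iff d_def)
    then show ?thesis using rigidity_image_add[OF G b c] by blast
  qed
  ultimately show ?thesis
    using edge_operator_in_rigidity_image by (auto simp: bij_betw_def)
qed

text \<open>
  An eigenvector \<open>a + \<i> b\<close> either restricts to an eigenvector on \<open>G'\<close>, or lies over zero. In the
  second case \<open>2 \<parallel>A\<^sup>T a\<parallel>\<^sup>2 + 2 \<parallel>A\<^sup>T b\<parallel>\<^sup>2 = Re \<mu> (\<parallel>a\<parallel>\<^sup>2 + \<parallel>b\<parallel>\<^sup>2)\<close>, the terms with \<open>Im \<mu>\<close> cancelling, and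
  the left side is positive.
\<close>

lemma positive_spectrum_extend:
  assumes rigid: "infinitesimally_rigid G' p" and pos: "positive_spectrum G' p"
  shows "positive_spectrum G p"
  unfolding positive_spectrum_def
proof
  fix \<mu> assume "\<mu> \<in> eigenvalues_on (rigidity_image G p) (edge_operator G p)"
  then obtain a b where ab: "a \<in> rigidity_image G p" "b \<in> rigidity_image G p"
      "a \<noteq> (\<lambda>_. 0) \<or> b \<noteq> (\<lambda>_. 0)"
    and op_a: "\<And>e. edge_operator G p a e = Re \<mu> * a e - Im \<mu> * b e"
    and op_b: "\<And>e. edge_operator G p b e = Re \<mu> * b e + Im \<mu> * a e"
    by (auto simp: edge_eigenvalue_iff)
  show "Re \<mu> > 0"
  proof (cases "restr a = (\<lambda>_. 0) \<and> restr b = (\<lambda>_. 0)")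
    case False
    have "edge_operator G' p (restr a) e = Re \<mu> * restr a e - Im \<mu> * restr b e" for e
      using op_a[of e] edge_operator_restr[of e a]
      by (cases "e \<in> parcs G'") (auto simp: restr_def edge_operator_def)
    moreover have "edge_operator G' p (restr b) e = Re \<mu> * restr b e + Im \<mu> * restr a e" for e
      using op_b[of e] edge_operator_restr[of e b]
      by (cases "e \<in> parcs G'") (auto simp: restr_def edge_operator_def)
    ultimately have "\<mu> \<in> eigenvalues_on (rigidity_image G' p) (edge_operator G' p)"
      unfolding edge_eigenvalue_iff using False restr_in_image ab(1,2) by blast
    then show ?thesis using pos by (auto simp: positive_spectrum_def)
  next
    case True
    define A B where "A = tail_load G p a v" and "B = tail_load G p b v"
    have quad: "(\<Sum>h\<in>N. w (v, h) * edge_operator G p w (v, h)) = 2 * (tail_load G p w v \<bullet> tail_load G p w v)"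
      if "restr w = (\<lambda>_. 0)" for w
    proof -
      have "(\<Sum>h\<in>N. w (v, h) * edge_operator G p w (v, h)) =
          2 * ((\<Sum>h\<in>N. w (v, h) *\<^sub>R (p v - p h)) \<bullet> tail_load G p w v)"
        by (simp add: edge_operator_fibre[OF that] inner_sum_left sum_distrib_left mult_ac)
      then show ?thesis by (simp add: tail_load_source)
    qed
    have "2 * (A \<bullet> A) + 2 * (B \<bullet> B) =
        (\<Sum>h\<in>N. a (v, h) * edge_operator G p a (v, h) + b (v, h) * edge_operator G p b (v, h))"
      using quad True by (simp add: A_def B_def sum.distrib)
    also have "\<dots> = Re \<mu> * (\<Sum>h\<in>N. a (v, h) * a (v, h) + b (v, h) * b (v, h))"
      by (simp add: op_a op_b sum_distrib_left algebra_simps)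
    finally have "2 * (A \<bullet> A) + 2 * (B \<bullet> B) = Re \<mu> * (\<Sum>h\<in>N. a (v, h) * a (v, h) + b (v, h) * b (v, h))" .
    moreover have "2 * (A \<bullet> A) + 2 * (B \<bullet> B) > 0"
    proof -
      have "A \<noteq> 0 \<or> B \<noteq> 0"
        using fibre_load_nonzero[OF rigid ab(1)] fibre_load_nonzero[OF rigid ab(2)] True ab(3)
        by (auto simp: A_def B_def)
      then have "A \<bullet> A > 0 \<or> B \<bullet> B > 0" by simp
      then show ?thesis using inner_ge_zero[of A] inner_ge_zero[of B] by linarith
    qed
    moreover have "(\<Sum>h\<in>N. a (v, h) * a (v, h) + b (v, h) * b (v, h)) \<ge> 0"
      by (intro sum_nonneg) auto
    ultimately show ?thesis by (simp add: zero_less_mult_iff)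
  qed
qed

end


section \<open>Restriction of configurations\<close>

lemma
  assumes G: "pair_digraph G" and W: "pverts G \<subseteq> W"
  shows stretch_restrict: "e \<in> pverts G \<times> pverts G \<Longrightarrow> stretch (restrict_config W p) x e = stretch p x e"
    and rigidity_image_restrict: "rigidity_image G (restrict_config W p) = rigidity_image G p"
    and edge_operator_restrict: "edge_operator G (restrict_config W p) = edge_operator G p"
proof -
  interpret pair_digraph G by fact
  have r: "restrict_config W p v = p v" if "v \<in> pverts G" for v
    using that W by (auto simp: restrict_config_def)
  show s: "stretch (restrict_config W p) x e = stretch p x e" if "e \<in> pverts G \<times> pverts G" for x e
    using that by (auto simp: stretch_def r)
  have E: "e \<in> pverts G \<times> pverts G" if "e \<in> parcs G" for e
    using arc_fst_in_verts[OF that] arc_snd_in_verts[OF that] by (cases e) simp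
  have "(\<lambda>e. if e \<in> parcs G then stretch (restrict_config W p) x e else 0) =
      (\<lambda>e. if e \<in> parcs G then stretch p x e else 0)" for x
    using s[OF E] by (auto simp: fun_eq_iff)
  then show "rigidity_image G (restrict_config W p) = rigidity_image G p"
    by (intro set_eqI) (simp add: rigidity_image_iff[OF G])
  have "rigidity_matrix (restrict_config W p) e = rigidity_matrix p e" if "e \<in> parcs G" for e
    using E[OF that] by (cases e) (auto simp: rigidity_matrix_def r fun_eq_iff)
  moreover from this have "directed_rigidity_matrix (restrict_config W p) e = directed_rigidity_matrix p e"
    if "e \<in> parcs G" for e
    using that by (cases e) (auto simp: directed_rigidity_matrix_def fun_eq_iff)
  ultimately show "edge_operator G (restrict_config W p) = edge_operator G p"
    by (auto simp: edge_operator_def edge_matrix_def fun_eq_iff intro!: sum.cong)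
qed

lemma infinitesimally_rigid_restrict:
  assumes G: "pair_digraph G" and W: "pverts G \<subseteq> W"
  shows "infinitesimally_rigid G (restrict_config W p) \<longleftrightarrow> infinitesimally_rigid G p"
proof -
  interpret pair_digraph G by fact
  have "e \<in> pverts G \<times> pverts G" if "e \<in> parcs G" for e
    using arc_fst_in_verts[OF that] arc_snd_in_verts[OF that] by (cases e) simp
  then show ?thesis
    unfolding infinitesimally_rigid_def by (simp add: stretch_restrict[OF assms] cong: ball_cong)
qed

lemma positive_spectrum_restrict:
  assumes "pair_digraph G" "pverts G \<subseteq> W"
  shows "positive_spectrum G (restrict_config W p) \<longleftrightarrow> positive_spectrum G p"
  by (simp add: positive_spectrum_def rigidity_image_restrict[OF assms] edge_operator_restrict[OF assms])


section \<open>Stable root extensions\<close>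

lemma admissible_add_source:
  fixes G :: "'v pair_pre_digraph"
  assumes G: "pair_digraph G" and v: "v \<in> pverts G" "\<And>x. (x, v) \<notin> parcs G"
    and deg: "CARD('d::finite) \<le> card {w. (v, w) \<in> parcs G}"
    and adm: "admissible TYPE('d) (delete_vertex G v)"
  shows "admissible TYPE('d) G"
    and "for_generic (pverts G) (\<lambda>p :: 'v \<Rightarrow> real^'d.
      positive_spectrum (delete_vertex G v) p \<longrightarrow> positive_spectrum G p)"
proof -
  interpret pair_digraph G by fact
  define H where "H = delete_vertex G v"
  have H: "pair_digraph H"
    using arc_fst_in_verts arc_snd_in_verts pair_no_loops unfolding H_def
    by unfold_locales (auto simp: delete_vertex_def pair_finite_verts pair_finite_arcs)
  have VH: "pverts H \<subseteq> pverts G" by (auto simp: H_def delete_vertex_def)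
  have "finite {w. (v, w) \<in> parcs G}"
    by (rule finite_subset[OF _ pair_finite_verts]) (auto simp: in_arcsD2)
  then obtain u :: "'d \<Rightarrow> 'v" where u: "inj u" "range u \<subseteq> {w. (v, w) \<in> parcs G}"
    using deg inj_on_iff_card_le[of "UNIV :: 'd set" "{w. (v, w) \<in> parcs G}"] by auto
  have rigidH: "generically_rigid TYPE('d) H" using adm by (simp add: admissible_def H_def)
  have ext: "source_extension G v p u" if "general_position (pverts G) p" for p :: "'v \<Rightarrow> real^'d"
    using that G v u by unfold_locales auto
  have gp: "for_generic (pverts G) (\<lambda>p :: 'v \<Rightarrow> real^'d. general_position (pverts G) p)"
    by (rule generic_general_position[OF pair_finite_verts])
  have inf: "for_generic (pverts G) (\<lambda>p :: 'v \<Rightarrow> real^'d. infinitesimally_rigid H p)"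
    using for_generic_restrict[OF generically_rigid_imp_infinitesimally_rigid[OF H rigidH] VH]
    by (simp add: infinitesimally_rigid_restrict[OF H])
  have "generically_rigid TYPE('d) G"
    unfolding generically_rigid_def
    by (rule for_generic_mono[OF for_generic_conj[OF gp
          for_generic_restrict[OF rigidH[unfolded generically_rigid_def] VH]]])
      (auto intro: source_extension.locally_rigid_extend[OF ext] simp: H_def)
  moreover have "for_generic (pverts G) (\<lambda>p :: 'v \<Rightarrow> real^'d.
      bij_betw (edge_operator H p) (rigidity_image H p) (rigidity_image H p))"
    using adm for_generic_restrict[OF _ VH, of "\<lambda>p :: 'v \<Rightarrow> real^'d.
      bij_betw (edge_operator H p) (rigidity_image H p) (rigidity_image H p)"]
    by (simp add: admissible_def H_def[symmetric] rigidity_image_restrict[OF H] edge_operator_restrict[OF H])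
  then have "for_generic (pverts G) (\<lambda>p :: 'v \<Rightarrow> real^'d.
      bij_betw (edge_operator G p) (rigidity_image G p) (rigidity_image G p))"
    by (rule for_generic_mono[OF for_generic_conj[OF for_generic_conj[OF gp inf]]])
      (auto intro: source_extension.bij_extend[OF ext] simp: H_def)
  ultimately show "admissible TYPE('d) G" by (simp add: admissible_def)
  show "for_generic (pverts G) (\<lambda>p :: 'v \<Rightarrow> real^'d.
      positive_spectrum (delete_vertex G v) p \<longrightarrow> positive_spectrum G p)"
    by (rule for_generic_mono[OF for_generic_conj[OF gp inf]])
      (auto intro: source_extension.positive_spectrum_extend[OF ext] simp: H_def)
qed

text \<open>
  A finite acyclic graph has a source, and a source of the complement of \<open>H\<close> receives no arc from \<open>H\<close>
  either; so the vertices outside \<open>H\<close> can be removed one at a time, each a source when it is removed.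
  Since arcs out of the other vertices avoid a source, the out-degrees survive the removal.
\<close>

lemma root_extension_induct:
  fixes G H :: "'v pair_pre_digraph"
  assumes "pair_digraph G"
    and "pverts H \<subseteq> pverts G"
    and "parcs H = parcs G \<inter> (pverts H \<times> pverts H)"
    and "acyclic (parcs G \<inter> ((pverts G - pverts H) \<times> (pverts G - pverts H)))"
    and "\<And>a b. (a, b) \<in> parcs G \<Longrightarrow> a \<in> pverts H \<Longrightarrow> b \<in> pverts H"
    and "\<And>v. v \<in> pverts G - pverts H \<Longrightarrow> CARD('d::finite) \<le> card {w. (v, w) \<in> parcs G}"
    and "admissible TYPE('d) H"
  shows "admissible TYPE('d) G \<and> for_generic (pverts G) (\<lambda>p :: 'v \<Rightarrow> real^'d.
    positive_spectrum H p \<longrightarrow> positive_spectrum G p)"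
  using assms
proof (induction "card (pverts G - pverts H)" arbitrary: G)
  case 0
  interpret pair_digraph G by fact
  have "pverts G = pverts H" using 0 pair_finite_verts by auto
  moreover have "parcs G \<subseteq> pverts G \<times> pverts G" by (auto simp: in_arcsD1 in_arcsD2)
  ultimately have "parcs G = parcs H" using 0 by auto
  then have "G = H" using \<open>pverts G = pverts H\<close> by (intro pair_pre_digraph.equality) auto
  then show ?case using 0 by (simp add: for_generic_True)
next
  case (Suc n)
  interpret pair_digraph G by fact
  define U where "U = pverts G - pverts H"
  define r where "r = parcs G \<inter> (U \<times> U)"
  have "U \<noteq> {}"
  proof
    assume "U = {}"
    then show False using Suc.hyps(2) unfolding U_def[symmetric] by simp
  qed
  moreover have "wf r"
    using Suc.prems(4) pair_finite_arcs by (intro finite_acyclic_wf) (auto simp: r_def U_def)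
  ultimately obtain v where v: "v \<in> U" "\<And>y. (y, v) \<in> r \<Longrightarrow> y \<notin> U" by (metis wfE_min ex_in_conv)
  have source: "(x, v) \<notin> parcs G" for x
  proof
    assume x: "(x, v) \<in> parcs G"
    have "x \<notin> pverts H" using Suc.prems(5)[OF x] v(1) by (simp add: U_def) blast
    then have "x \<in> U" using in_arcsD1[OF x] by (simp add: U_def)
    then show False using v(2)[of x] v(1) x by (simp add: r_def)
  qed
  define G' where "G' = delete_vertex G v"
  have V': "pverts G' = pverts G - {v}" and E': "parcs G' = {e \<in> parcs G. fst e \<noteq> v \<and> snd e \<noteq> v}"
    by (simp_all add: G'_def delete_vertex_def)
  have "pair_digraph G'"
    using arc_fst_in_verts arc_snd_in_verts pair_no_loops
    by unfold_locales (auto simp: V' E' pair_finite_verts pair_finite_arcs)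
  moreover have "n = card (pverts G' - pverts H)"
  proof -
    have "pverts G' - pverts H = U - {v}" by (auto simp: V' U_def)
    moreover have "finite U" using pair_finite_verts by (simp add: U_def)
    ultimately show ?thesis using Suc.hyps(2) v by (simp add: U_def[symmetric])
  qed
  moreover have "pverts H \<subseteq> pverts G'" using Suc.prems(2) v by (auto simp: V' U_def)
  moreover have "parcs H = parcs G' \<inter> (pverts H \<times> pverts H)"
    using Suc.prems(3) v by (auto simp: E' U_def)
  moreover have "acyclic (parcs G' \<inter> ((pverts G' - pverts H) \<times> (pverts G' - pverts H)))"
    by (rule acyclic_subset[OF Suc.prems(4)]) (auto simp: E' V')
  moreover have "b \<in> pverts H" if "(a, b) \<in> parcs G'" "a \<in> pverts H" for a b
    using that Suc.prems(5)[of a b] by (auto simp: E')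
  moreover have "CARD('d) \<le> card {w. (x, w) \<in> parcs G'}" if x: "x \<in> pverts G' - pverts H" for x
  proof -
    have "{w. (x, w) \<in> parcs G'} = {w. (x, w) \<in> parcs G}" using x source by (auto simp: E' V')
    then show ?thesis using Suc.prems(6)[of x] x by (auto simp: V')
  qed
  ultimately have IH: "admissible TYPE('d) G'" "for_generic (pverts G') (\<lambda>p :: 'v \<Rightarrow> real^'d.
      positive_spectrum H p \<longrightarrow> positive_spectrum G' p)"
    using Suc.hyps(1)[of G'] Suc.prems(7) by auto
  have vG: "v \<in> pverts G" "v \<in> pverts G - pverts H" using v by (auto simp: U_def)
  note step = admissible_add_source[OF Suc.prems(1) vG(1) source Suc.prems(6)[OF vG(2)] IH(1)[unfolded G'_def]]
  have H: "pair_digraph H"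
    using Suc.prems(3) pair_no_loops Suc.prems(2)
    by unfold_locales (auto intro: finite_subset[OF _ pair_finite_verts] finite_subset[OF _ pair_finite_arcs])
  have "for_generic (pverts G) (\<lambda>p :: 'v \<Rightarrow> real^'d. positive_spectrum H p \<longrightarrow> positive_spectrum G' p)"
    using for_generic_restrict[OF IH(2), of "pverts G"] \<open>pverts H \<subseteq> pverts G'\<close>
    by (simp add: V' positive_spectrum_restrict[OF H] positive_spectrum_restrict[OF \<open>pair_digraph G'\<close>])
  then have "for_generic (pverts G) (\<lambda>p :: 'v \<Rightarrow> real^'d. positive_spectrum H p \<longrightarrow> positive_spectrum G p)"
    by (rule for_generic_mono[OF for_generic_conj[OF step(2)]]) (simp add: G'_def)
  then show ?case using step(1) by simp
qed

theorem mainTheorem6: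
  fixes G H :: "'v pair_pre_digraph"
  assumes "oriented_graph G"
    and "oriented_graph H"
    and "admissible TYPE('d::finite) H"
    and "stable_root_extension TYPE('d) G H"
  shows "admissible TYPE('d) G \<and>
    for_generic (pverts G) (\<lambda>p :: 'v \<Rightarrow> real^'d.
      (\<forall>\<mu> \<in> eigenvalues_on (vectors_on (parcs H))
              (edge_operator H (restrict_config (pverts H) p)). \<mu> \<noteq> 0 \<longrightarrow> Re \<mu> > 0)
      \<longrightarrow> strongly_admissible TYPE('d) G)"
proof -
  have G: "pair_digraph G" and H: "pair_digraph H"
    using assms by (auto simp: oriented_graph_def)
  have root: "root_extension G H"
    and deg: "\<And>v. v \<in> pverts G - pverts H \<Longrightarrow> CARD('d) \<le> out_degree (with_proj G) v"
    using assms(4) by (auto simp: stable_root_extension_def)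
  have ind: "induced_subgraph (with_proj H) (with_proj G)"
    using root by (simp add: root_extension_def)
  have VH: "pverts H \<subseteq> pverts G"
    using ind by (auto simp: induced_subgraph_def subgraph_def)
  have EH: "parcs H = parcs G \<inter> (pverts H \<times> pverts H)"
  proof -
    have "parcs H = {e \<in> parcs G. fst e \<in> pverts H \<and> snd e \<in> pverts H}"
      using ind unfolding induced_subgraph_def with_proj_simps by blast
    then show ?thesis by (simp only:) (rule set_eqI, simp add: mem_Times_iff)
  qed
  have ac: "acyclic (parcs G \<inter> ((pverts G - pverts H) \<times> (pverts G - pverts H)))"
  proof (rule acyclic_subset)
    show "acyclic (arcs_ends (with_proj G \<restriction> (pverts G - pverts H)))"
      using root by (simp add: root_extension_def)
    show "parcs G \<inter> ((pverts G - pverts H) \<times> (pverts G - pverts H))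
        \<subseteq> arcs_ends (with_proj G \<restriction> (pverts G - pverts H))"
      unfolding arcs_ends_conv induce_subgraph_tail induce_subgraph_head induce_subgraph_arcs with_proj_simps
      by auto
  qed
  have closed: "b \<in> pverts H" if "(a, b) \<in> parcs G" "a \<in> pverts H" for a b
    using root that pair_wf_digraph.in_arcsD2[of G a b] G
    by (auto simp: root_extension_def pair_digraph_def pair_fin_digraph_def)
  have "card {w. (v, w) \<in> parcs G} = out_degree (with_proj G) v" for v
  proof -
    have "out_arcs (with_proj G) v = Pair v ` {w. (v, w) \<in> parcs G}"
      by (auto simp: out_arcs_def)
    then show ?thesis by (simp add: out_degree_def card_image inj_on_def)
  qed
  then have main: "admissible TYPE('d) G" "for_generic (pverts G) (\<lambda>p :: 'v \<Rightarrow> real^'d.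
      positive_spectrum H p \<longrightarrow> positive_spectrum G p)"
    using root_extension_induct[OF G VH EH ac closed _ assms(3)] deg by auto
  have strong: "for_generic (pverts G) (\<lambda>p :: 'v \<Rightarrow> real^'d.
      positive_spectrum G p \<longrightarrow> strongly_admissible TYPE('d) G)"
    by (rule generic_positive_spectrum_imp_strongly_admissible[OF G]) (use main(1) in \<open>simp add: admissible_def\<close>)
  have bij: "for_generic (pverts G) (\<lambda>p :: 'v \<Rightarrow> real^'d.
      bij_betw (edge_operator H (restrict_config (pverts H) p))
        (rigidity_image H (restrict_config (pverts H) p)) (rigidity_image H (restrict_config (pverts H) p)))"
    using assms(3) by (intro for_generic_restrict[OF _ VH]) (simp add: admissible_def)
  \<comment> \<open>On the whole arc space \<open>Z\<close> may have a kernel; on the image invertibility excludes the eigenvalue 0.\<close>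
  have pos: "positive_spectrum H p"
    if bij: "bij_betw (edge_operator H (restrict_config (pverts H) p))
        (rigidity_image H (restrict_config (pverts H) p)) (rigidity_image H (restrict_config (pverts H) p))"
      and hyp: "\<forall>\<mu> \<in> eigenvalues_on (vectors_on (parcs H))
        (edge_operator H (restrict_config (pverts H) p)). \<mu> \<noteq> 0 \<longrightarrow> Re \<mu> > 0" for p :: "'v \<Rightarrow> real^'d"
  proof -
    define q where "q = restrict_config (pverts H) p"
    have "Re \<mu> > 0" if \<mu>: "\<mu> \<in> eigenvalues_on (rigidity_image H q) (edge_operator H q)" for \<mu>
    proof -
      have "rigidity_image H q \<subseteq> vectors_on (parcs H)" by (auto simp: rigidity_image_def vectors_on_def)
      then have "\<mu> \<in> eigenvalues_on (vectors_on (parcs H)) (edge_operator H q)"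
        using \<mu> unfolding eigenvalues_on_def complexification_def by blast
      moreover have "\<mu> \<noteq> 0"
      proof
        assume "\<mu> = 0"
        then obtain a b where ab: "a \<in> rigidity_image H q" "b \<in> rigidity_image H q"
          "a \<noteq> (\<lambda>_. 0) \<or> b \<noteq> (\<lambda>_. 0)" "edge_operator H q a = (\<lambda>_. 0)" "edge_operator H q b = (\<lambda>_. 0)"
          using \<mu> by (auto simp: edge_eigenvalue_iff fun_eq_iff)
        have inj: "inj_on (edge_operator H q) (rigidity_image H q)"
          using bij by (auto simp: bij_betw_def q_def)
        have "x = (\<lambda>_. 0)" if "x \<in> rigidity_image H q" "edge_operator H q x = (\<lambda>_. 0)" for x
          using inj_onD[OF inj, of x "\<lambda>_. 0"] that rigidity_image_zero[OF H, of q]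
          by (simp add: edge_operator_zero)
        then show False using ab by blast
      qed
      ultimately show ?thesis using hyp by (simp add: q_def)
    qed
    then have "positive_spectrum H q" by (simp add: positive_spectrum_def)
    then show ?thesis by (simp add: q_def positive_spectrum_restrict[OF H])
  qed
  have "for_generic (pverts G) (\<lambda>p :: 'v \<Rightarrow> real^'d.
      (\<forall>\<mu> \<in> eigenvalues_on (vectors_on (parcs H))
              (edge_operator H (restrict_config (pverts H) p)). \<mu> \<noteq> 0 \<longrightarrow> Re \<mu> > 0)
      \<longrightarrow> strongly_admissible TYPE('d) G)"
    by (rule for_generic_mono[OF for_generic_conj[OF bij for_generic_conj[OF main(2) strong]]])
      (use pos in blast)
  then show ?thesis using main(1) by blast
qed

end
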